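(* Let $\kappa_1 = \frac{2\log \lambda_1}{\log 2}$, where $\lambda_1 = \frac{1+\sqrt{5}}{2}$ (so $\kappa_1 = 1.388\ldots$). 1. Let $x\in(0,1)$ be irrational with regular continued fraction expansion $x=[0;a_1,\ldots,a_t,\ldots]$, and suppose that $$\limsup_{t\to\infty}\frac{a_1+\cdots+a_t}{t}<\kappa_1 .$$ Then the derivative $?'(x)$ exists and $?'(x)=+\infty$. 2. For every $\varepsilon>0$ there exists a quadratic irrationality $x=[0;a_1,\ldots,a_t,\ldots]\in(0,1)$ such that the limit below exists and satisfies $$\lim_{t\to\infty}\frac{a_1+\cdots+a_t}{t}\le \kappa_1+\varepsilon ,$$ and $?'(x)=0$.
   Context: The Minkowski question mark function $?:[0,1]\to[0,1]$ is defined as follows: $?(0)=0$, $?(1)=1$; if $?$ is already defined at successive Farey fractions $\frac pq<\frac{p'}{q'}$ (reduced fractions with $p'q-pq'=1$), then $?\left(\frac{p+p'}{q+q'}\right)=\frac12\left(?\left(\frac pq\right)+?\left(\frac{p'}{q'}\right)\right)$; at irrational $x$ it is defined by continuity. It is continuous and increasing, and for irrational $x=[0;a_1,a_2,\ldots]$ one has $?(x)=\sum_{n\ge1}\frac{(-1)^{n+1}}{2^{a_1+\cdots+a_n-1}}$. The notation $[0;a_1,a_2,\ldots]$ denotes the regular continued fraction $\cfrac{1}{a_1+\cfrac{1}{a_2+\cdots}}$ with partial quotients $a_i$ positive integers. The derivative $?'(x)=\lim_{\delta\to0}\frac{?(x+\delta)-?(x)}{\delta}$ is the two-sided limit, with the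 value $+\infty$ allowed. $\log$ is the natural logarithm. *)

theory Defs
  imports "HOL-Analysis.Analysis"
begin

text \<open>
  The graph of the question mark function on the rationals in \<open>[0, 1]\<close>, generated by the mediant
  rule for Farey neighbours. The determinant condition makes all fractions reduced, and a
  fraction that is a mediant has only one pair of neighbours as parents, so the relation is
  single-valued.
\<close>

inductive minkowski_rat :: "real \<Rightarrow> real \<Rightarrow> bool" where
  zero: "minkowski_rat 0 0"
| one: "minkowski_rat 1 1"
| mediant: "minkowski_rat ((of_int p + of_int p') / (of_int q + of_int q')) ((u + v) / 2)"
    if "minkowski_rat (of_int p / of_int q) u" "minkowski_rat (of_int p' / of_int q') v"
       "0 < q" "0 < q'" "p' * q - p * q' = 1"
    for p q p' q' :: int

text \<open>Only the values on \<open>[0, 1]\<close> are meaningful; outside this interval the value is unspecified.\<close>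

definition minkowski :: "real \<Rightarrow> real" where
  "minkowski x =
    (if x \<in> \<rat> then THE y. minkowski_rat x y
     else Lim (at x within \<rat> \<inter> {0..1}) (\<lambda>r. THE y. minkowski_rat r y))"

text \<open>
  The finite continued fraction \<open>[0; a 1, ..., a n]\<close>. Partial quotients are indexed from 1; the
  entry \<open>a 0\<close> is ignored.
\<close>

fun cfrac_fin :: "(nat \<Rightarrow> nat) \<Rightarrow> nat \<Rightarrow> real" where
  "cfrac_fin a 0 = 0"
| "cfrac_fin a (Suc n) = 1 / (real (a 1) + cfrac_fin (\<lambda>i. a (i + 1)) n)"

definition is_cfrac :: "real \<Rightarrow> (nat \<Rightarrow> nat) \<Rightarrow> bool" where
  "is_cfrac x a \<longleftrightarrow> (\<forall>i\<ge>1. a i > 0) \<and> cfrac_fin a \<longlonglongrightarrow> x"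

definition quadratic_irrational :: "real \<Rightarrow> bool" where
  "quadratic_irrational x \<longleftrightarrow>
    x \<notin> \<rat> \<and> (\<exists>a b c :: int. a \<noteq> 0 \<and> of_int a * x\<^sup>2 + of_int b * x + of_int c = 0)"

text \<open>Two-sided derivative, possibly infinite.\<close>

definition has_ereal_derivative :: "(real \<Rightarrow> real) \<Rightarrow> ereal \<Rightarrow> real \<Rightarrow> bool" where
  "has_ereal_derivative f D x \<longleftrightarrow> ((\<lambda>h. ereal ((f (x + h) - f x) / h)) \<longlongrightarrow> D) (at 0)"

definition lambda1 :: real where
  "lambda1 = (1 + sqrt 5) / 2"

definition kappa1 :: real where
  "kappa1 = 2 * ln lambda1 / ln 2"

end

theory Submission
  imports Defs
begin

text \<open>
  Locating \<open>x\<close> in the Stern-Brocot tree gives nested Farey intervals of length \<open>1 / (q q')\<close> whose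
  image under the question mark function has length \<open>1 / 2 ^ n\<close> at depth \<open>n\<close>. For
  \<open>x = [0; a 1, a 2, ...]\<close> with partial sums \<open>S t\<close> and convergent denominators \<open>q t\<close>, the path
  turns only at the depths \<open>S t - 1\<close>, and there \<open>{q, q'} = {q t, q (t - 1)}\<close>. If \<open>y\<close> leaves the
  intervals at a depth of block \<open>t\<close>, then the end of the interval that separates \<open>y\<close> from \<open>x\<close> moves
  again no later than in block \<open>t + 2\<close>, which traps the difference quotient between
  \<open>q t * q (t - 1) / 2 ^ S (t + 2)\<close> and \<open>2 * (q (t + 3))\<^sup>2 / 2 ^ S t\<close>.

  Since \<open>q t \<ge> lambda1 ^ (t - 1)\<close>, the lower bound tends to infinity when \<open>S t \<le> \<kappa> t\<close> with
  \<open>\<kappa> < kappa1\<close>. For the second part take the period \<open>1, ..., 1, B\<close> with \<open>m\<close> ones and \<open>B\<close> about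
  \<open>(kappa1 - 1 + \<epsilon> / 2) m\<close>: one period multiplies \<open>q\<^sup>2\<close> by at most \<open>((B + 1) lambda1 ^ (m + 1))\<^sup>2\<close>,
  which is less than \<open>2 ^ (m + B)\<close> for large \<open>m\<close>, so the upper bound tends to 0.
\<close>

section \<open>The Farey path of a real number\<close>

text \<open>The quadruple \<open>(p, q, p', q')\<close> stands for the interval from
  \<open>p / q\<close> to \<open>p' / q'\<close>. A point equal to the mediant goes right, so the
  intervals are closed on the left and open on the right.\<close>

primrec farey :: "real \<Rightarrow> nat \<Rightarrow> int \<times> int \<times> int \<times> int" where
  "farey x 0 = (0, 1, 1, 1)"
| "farey x (Suc n) = (case farey x n of (p, q, p', q') \<Rightarrow>
     if of_int (p + p') \<le> x * of_int (q + q') then (p + p', q + q', p', q')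
     else (p, q, p + p', q + q'))"

definition lnum :: "real \<Rightarrow> nat \<Rightarrow> int" where "lnum x n = fst (farey x n)"
definition lden :: "real \<Rightarrow> nat \<Rightarrow> int" where "lden x n = fst (snd (farey x n))"
definition rnum :: "real \<Rightarrow> nat \<Rightarrow> int" where "rnum x n = fst (snd (snd (farey x n)))"
definition rden :: "real \<Rightarrow> nat \<Rightarrow> int" where "rden x n = snd (snd (snd (farey x n)))"

lemmas farey_proj_defs = lnum_def lden_def rnum_def rden_def

definition turns_right :: "real \<Rightarrow> nat \<Rightarrow> bool" where
  "turns_right x n \<longleftrightarrow> of_int (lnum x n + rnum x n) \<le> x * of_int (lden x n + rden x n)"

definition lend :: "real \<Rightarrow> nat \<Rightarrow> real" where "lend x n = of_int (lnum x n) / of_int (lden x n)"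
definition rend :: "real \<Rightarrow> nat \<Rightarrow> real" where "rend x n = of_int (rnum x n) / of_int (rden x n)"

text \<open>A right turn is the binary digit 1, a left turn the digit 0; the partial sum turns out
  to be the value of the question mark function at the left end.\<close>

primrec lval :: "real \<Rightarrow> nat \<Rightarrow> real" where
  "lval x 0 = 0"
| "lval x (Suc n) = lval x n + (if turns_right x n then 1 / 2 ^ Suc n else 0)"

definition qmark :: "real \<Rightarrow> real" where "qmark x = lim (lval x)"

lemma farey_eq: "farey x n = (lnum x n, lden x n, rnum x n, rden x n)"
  by (simp add: farey_proj_defs)

lemma farey_zero [simp]: "lnum x 0 = 0" "lden x 0 = 1" "rnum x 0 = 1" "rden x 0 = 1"
  by (simp_all add: farey_proj_defs)

lemma farey_right:
  assumes "turns_right x n"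
  shows "lnum x (Suc n) = lnum x n + rnum x n" "lden x (Suc n) = lden x n + rden x n"
    "rnum x (Suc n) = rnum x n" "rden x (Suc n) = rden x n"
  using assms unfolding turns_right_def farey_proj_defs
  by (simp_all add: case_prod_beta)

lemma farey_left:
  assumes "\<not> turns_right x n"
  shows "lnum x (Suc n) = lnum x n" "lden x (Suc n) = lden x n"
    "rnum x (Suc n) = lnum x n + rnum x n" "rden x (Suc n) = lden x n + rden x n"
  using assms unfolding turns_right_def farey_proj_defs
  by (simp_all add: case_prod_beta)

lemmas farey_steps = farey_left farey_right

lemma farey_dens_pos: "0 < lden x n" "0 < rden x n"
proof -
  have "0 < lden x n \<and> 0 < rden x n"
  proof (induction n)
    case (Suc n)
    then show ?case by (cases "turns_right x n") (simp_all add: farey_steps)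
  qed simp
  then show "0 < lden x n" "0 < rden x n" by auto
qed

lemma farey_det: "rnum x n * lden x n - lnum x n * rden x n = 1"
proof (induction n)
  case (Suc n)
  then show ?case by (cases "turns_right x n") (simp_all add: farey_steps algebra_simps)
qed simp

lemma farey_nums: "0 \<le> lnum x n \<and> 0 \<le> rnum x n \<and> lnum x n \<le> lden x n \<and> rnum x n \<le> rden x n"
proof (induction n)
  case (Suc n)
  then show ?case by (cases "turns_right x n") (simp_all add: farey_steps)
qed simp

lemma farey_den_sum: "int n + 2 \<le> lden x n + rden x n"
proof (induction n)
  case (Suc n)
  then show ?case
    using farey_dens_pos[of x n] by (cases "turns_right x n") (simp_all add: farey_steps)
qed simp

lemma lend_rend_bounds: "0 \<le> lend x n" "rend x n \<le> 1"
  using farey_nums[of x n] farey_dens_pos[of x n] by (auto simp: lend_def rend_def)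

lemma rend_minus_lend: "rend x n - lend x n = 1 / (of_int (lden x n) * of_int (rden x n))"
proof -
  have "of_int (rnum x n * lden x n - lnum x n * rden x n) = (1::real)"
    by (simp only: farey_det of_int_1)
  then show ?thesis
    using farey_dens_pos[of x n] by (simp add: lend_def rend_def field_simps)
qed

lemma lend_less_rend: "lend x n < rend x n"
proof -
  have "0 < rend x n - lend x n"
    unfolding rend_minus_lend using farey_dens_pos[of x n] by simp
  then show ?thesis by simp
qed

lemma rend_minus_lend_le: "rend x n - lend x n \<le> 1 / (real n + 1)"
proof -
  \<comment> \<open>This turns the linear growth of the sum of the denominators into linear growth
    of their product.\<close>
  have "0 \<le> (lden x n - 1) * (rden x n - 1)"
    using farey_dens_pos[of x n] by (intro mult_nonneg_nonneg) auto
  then have "int n + 1 \<le> lden x n * rden x n"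
    using farey_den_sum[of n x] by (simp add: algebra_simps)
  then have "real_of_int (int n + 1) \<le> real_of_int (lden x n * rden x n)"
    by (simp only: of_int_le_iff)
  then show ?thesis
    unfolding rend_minus_lend by (intro divide_left_mono) (simp_all add: farey_dens_pos)
qed

section \<open>Mediants and the movement of the two ends\<close>

definition mediant_of :: "real \<Rightarrow> nat \<Rightarrow> real" where
  "mediant_of x n = of_int (lnum x n + rnum x n) / of_int (lden x n + rden x n)"

lemma turns_right_iff: "turns_right x n \<longleftrightarrow> mediant_of x n \<le> x"
proof -
  have "0 < real_of_int (lden x n + rden x n)" using farey_dens_pos[of x n] by simp
  then show ?thesis unfolding turns_right_def mediant_of_def by (simp only: pos_divide_le_eq)
qed

lemma mediant_minus_lend:
  "mediant_of x n - lend x n = 1 / (of_int (lden x n) * of_int (lden x n + rden x n))"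
proof -
  have "of_int (rnum x n * lden x n - lnum x n * rden x n) = (1::real)"
    by (simp only: farey_det of_int_1)
  moreover have "0 < real_of_int (lden x n)" "0 < real_of_int (rden x n)"
    "0 < real_of_int (lden x n) + real_of_int (rden x n)"
    using farey_dens_pos[of x n] by (auto intro: add_pos_pos)
  ultimately show ?thesis
    by (simp add: lend_def mediant_of_def field_simps)
qed

lemma rend_minus_mediant:
  "rend x n - mediant_of x n = 1 / (of_int (rden x n) * of_int (lden x n + rden x n))"
proof -
  have "of_int (rnum x n * lden x n - lnum x n * rden x n) = (1::real)"
    by (simp only: farey_det of_int_1)
  moreover have "0 < real_of_int (lden x n)" "0 < real_of_int (rden x n)"
    "0 < real_of_int (lden x n) + real_of_int (rden x n)"
    using farey_dens_pos[of x n] by (auto intro: add_pos_pos)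
  ultimately show ?thesis
    by (simp add: rend_def mediant_of_def field_simps)
qed

lemma mediant_between: "lend x n < mediant_of x n" "mediant_of x n < rend x n"
proof -
  have *: "0 < real_of_int (lden x n)" "0 < real_of_int (rden x n)"
    "0 < real_of_int (lden x n + rden x n)"
    using farey_dens_pos[of x n] by auto
  then have "0 < mediant_of x n - lend x n" "0 < rend x n - mediant_of x n"
    unfolding mediant_minus_lend rend_minus_mediant by simp_all
  then show "lend x n < mediant_of x n" "mediant_of x n < rend x n" by simp_all
qed

lemma ends_right:
  assumes "turns_right x n"
  shows "lend x (Suc n) = mediant_of x n" "rend x (Suc n) = rend x n"
  using assms by (simp_all add: lend_def rend_def mediant_of_def farey_right)

lemma ends_left:
  assumes "\<not> turns_right x n"
  shows "lend x (Suc n) = lend x n" "rend x (Suc n) = mediant_of x n"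
  using assms by (simp_all add: lend_def rend_def mediant_of_def farey_left)

lemmas ends_steps = ends_left ends_right

lemma lend_Suc: "lend x n \<le> lend x (Suc n)"
  using mediant_between[of x n] by (cases "turns_right x n") (simp_all add: ends_steps)

lemma rend_Suc: "rend x (Suc n) \<le> rend x n"
  using mediant_between[of x n] by (cases "turns_right x n") (simp_all add: ends_steps)

lemma lend_mono: "m \<le> n \<Longrightarrow> lend x m \<le> lend x n"
  by (rule lift_Suc_mono_le[of "lend x"]) (rule lend_Suc)

lemma rend_antimono: "m \<le> n \<Longrightarrow> rend x n \<le> rend x m"
  by (rule lift_Suc_antimono_le[of "rend x"]) (rule rend_Suc)

lemma lden_mono: "m \<le> n \<Longrightarrow> lden x m \<le> lden x n"
proof (rule lift_Suc_mono_le[of "lden x"])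
  show "lden x n \<le> lden x (Suc n)" for n
    using farey_dens_pos[of x n] by (cases "turns_right x n") (simp_all add: farey_steps)
qed

lemma rden_mono: "m \<le> n \<Longrightarrow> rden x m \<le> rden x n"
proof (rule lift_Suc_mono_le[of "rden x"])
  show "rden x n \<le> rden x (Suc n)" for n
    using farey_dens_pos[of x n] by (cases "turns_right x n") (simp_all add: farey_steps)
qed

lemma ends_bracket:
  assumes "0 \<le> x" "x < 1"
  shows "lend x n \<le> x \<and> x < rend x n"
proof (induction n)
  case 0
  show ?case using assms by (simp add: lend_def rend_def)
next
  case (Suc n)
  then show ?case by (cases "turns_right x n") (auto simp: ends_steps turns_right_iff)
qed

section \<open>Comparing the paths of two points\<close>

text \<open>Every mediant tested before depth \<open>n\<close> becomes an end, so it is at most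
  \<open>lend y n\<close> or at least \<open>rend y n\<close>; it cannot separate two points of the
  half-open interval between them.\<close>

lemma farey_cong:
  assumes "lend y n \<le> x" "x < rend y n"
  shows "farey x n = farey y n \<and> lval x n = lval y n"
  using assms
proof (induction n)
  case (Suc n)
  have IH: "farey x n = farey y n" "lval x n = lval y n"
    using Suc lend_Suc[of y n] rend_Suc[of y n] by auto
  then have m: "mediant_of x n = mediant_of y n"
    by (simp add: mediant_of_def farey_proj_defs)
  have "turns_right x n = turns_right y n"
    using Suc.prems m by (cases "turns_right y n") (auto simp: turns_right_iff[of x] ends_steps)
  then show ?case
    using IH unfolding turns_right_def farey_proj_defs
    by (simp add: case_prod_beta turns_right_def farey_proj_defs)
qed simp

text \<open>At the first depth where the paths part, \<open>x\<close> turns left and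
  \<open>y\<close> right, which opens the gap. Afterwards \<open>lval x n + 1 / 2 ^ n\<close> never
  increases and \<open>lval y n\<close> never decreases, so the gap persists.\<close>

lemma farey_compare:
  assumes "x \<le> y"
  shows "farey x n = farey y n \<and> lval x n = lval y n \<or> lval x n + 1 / 2 ^ n \<le> lval y n"
proof (induction n)
  case (Suc n)
  show ?case
  proof (cases "lval x n + 1 / 2 ^ n \<le> lval y n")
    case True
    have "lval x (Suc n) + 1 / 2 ^ Suc n \<le> lval x n + 1 / 2 ^ n" by (simp add: field_simps)
    moreover have "lval y n \<le> lval y (Suc n)" by simp
    ultimately show ?thesis using True by linarith
  next
    case False
    then have IH: "farey x n = farey y n" "lval x n = lval y n" using Suc by auto
    then have m: "mediant_of x n = mediant_of y n"
      by (simp add: mediant_of_def farey_proj_defs)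
    show ?thesis
    proof (cases "turns_right x n = turns_right y n")
      case True
      then show ?thesis
        using IH unfolding turns_right_def farey_proj_defs
        by (simp add: case_prod_beta turns_right_def farey_proj_defs)
    next
      case False
      then have "\<not> turns_right x n" "turns_right y n"
        using m assms by (auto simp: turns_right_iff)
      then show ?thesis using IH by simp
    qed
  qed
qed simp

section \<open>The question mark function as a binary expansion\<close>

text \<open>The binary intervals from \<open>lval x n\<close> to \<open>lval x n + 1 / 2 ^ n\<close>
  are nested and shrink to one point.\<close>

lemma lval_LIMSEQ: "lval x \<longlonglongrightarrow> qmark x"
  and lval_le_qmark: "lval x n \<le> qmark x"
  and qmark_le_lval: "qmark x \<le> lval x n + 1 / 2 ^ n"
proof -
  have inc: "incseq (lval x)" by (rule incseq_SucI) simp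
  have dec: "decseq (\<lambda>n. lval x n + 1 / 2 ^ n)" by (rule decseq_SucI) (simp add: field_simps)
  have bd: "lval x n \<le> 1" for n
  proof -
    have "lval x n + 1 / 2 ^ n \<le> 1" using decseqD[OF dec, of 0 n] by simp
    then show ?thesis by (smt (verit) zero_le_divide_1_iff zero_le_power)
  qed
  obtain L where L: "lval x \<longlonglongrightarrow> L" using incseq_convergent[OF inc] bd by blast
  then show lim: "lval x \<longlonglongrightarrow> qmark x" unfolding qmark_def by (simp add: limI)
  show "lval x n \<le> qmark x" by (rule incseq_le[OF inc lim])
  have "(\<lambda>n. lval x n + (1/2) ^ n) \<longlonglongrightarrow> qmark x + 0"
    by (intro tendsto_add lim LIMSEQ_realpow_zero) auto
  then have "(\<lambda>n. lval x n + 1 / 2 ^ n) \<longlonglongrightarrow> qmark x" by (simp add: power_one_over)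
  then show "qmark x \<le> lval x n + 1 / 2 ^ n" by (rule decseq_ge[OF dec])
qed

lemma qmark_mono:
  assumes "x \<le> y"
  shows "qmark x \<le> qmark y"
proof (rule LIMSEQ_le[OF lval_LIMSEQ lval_LIMSEQ])
  have "lval x n \<le> lval y n" for n
    using farey_compare[OF assms, of n] by (smt (verit) zero_le_divide_1_iff zero_le_power)
  then show "\<exists>N. \<forall>n\<ge>N. lval x n \<le> lval y n" by blast
qed

text \<open>Once the left end is \<open>z\<close>, every later mediant exceeds \<open>z\<close>, so
  all further digits are 0 and the binary expansion stops.\<close>

lemma qmark_lend_self:
  assumes "lend z n = z"
  shows "qmark z = lval z n"
proof -
  have *: "lend z (n + k) = z \<and> lval z (n + k) = lval z n" for k
  proof (induction k)
    case (Suc k)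
    then have "\<not> turns_right z (n + k)"
      using mediant_between(1)[of z "n + k"] by (simp add: turns_right_iff)
    then show ?case using Suc by (simp add: ends_left)
  qed (use assms in simp)
  then have "(\<lambda>k. lval z (k + n)) = (\<lambda>k. lval z n)" by (simp add: add.commute)
  moreover have "(\<lambda>k. lval z (k + n)) \<longlonglongrightarrow> qmark z"
    using lval_LIMSEQ by (rule LIMSEQ_ignore_initial_segment)
  ultimately show ?thesis using LIMSEQ_unique tendsto_const by metis
qed

lemma qmark_lend: "qmark (lend x n) = lval x n"
proof -
  have "farey (lend x n) n = farey x n \<and> lval (lend x n) n = lval x n"
    by (rule farey_cong) (simp_all add: lend_less_rend)
  then show ?thesis
    using qmark_lend_self[of "lend x n" n] by (simp add: lend_def farey_proj_defs)
qed

lemma qmark_mediant: "qmark (mediant_of x n) = lval x n + 1 / 2 ^ Suc n"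
proof -
  define m where "m = mediant_of x n"
  have "farey m n = farey x n \<and> lval m n = lval x n"
    unfolding m_def using mediant_between by (intro farey_cong) (auto intro: less_imp_le)
  then have c: "mediant_of m n = m" "lval m n = lval x n"
    by (simp_all add: m_def mediant_of_def farey_proj_defs)
  then have "turns_right m n" by (simp add: turns_right_iff)
  then show ?thesis
    using qmark_lend_self[of m "Suc n"] c by (simp add: ends_right flip: m_def)
qed

text \<open>The path of 1 turns right for ever and never has 1 as its left end, so
  \<open>qmark_lend_self\<close> does not apply; all digits are 1. The value starts the induction
  for the right ends.\<close>

lemma qmark_1: "qmark 1 = 1"
proof -
  have *: "farey 1 n = (int n, int n + 1, 1, 1) \<and> lval 1 n = 1 - 1 / 2 ^ n" for n
  proof (induction n)
    case (Suc n)
    then have "turns_right 1 n" by (simp add: turns_right_def farey_proj_defs)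
    then show ?case using Suc by (simp add: field_simps)
  qed simp
  have "(\<lambda>n. 1 - (1/2::real) ^ n) \<longlonglongrightarrow> 1 - 0"
    by (intro tendsto_diff tendsto_const LIMSEQ_realpow_zero) auto
  moreover have "lval 1 = (\<lambda>n. 1 - (1/2) ^ n)" using * by (auto simp: power_one_over)
  ultimately show ?thesis using LIMSEQ_unique[OF lval_LIMSEQ] by auto
qed

lemma qmark_rend: "qmark (rend x n) = lval x n + 1 / 2 ^ n"
proof (induction n)
  case 0
  show ?case by (simp add: rend_def qmark_1)
next
  case (Suc n)
  show ?case
  proof (cases "turns_right x n")
    case True
    then show ?thesis using Suc by (simp add: ends_right field_simps)
  next
    case False
    then show ?thesis using qmark_mediant[of x n] by (simp add: ends_left)
  qed
qed

section \<open>Agreement with the mediant rule on the rationals\<close>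

text \<open>Descent to the parents: subtracting the fraction with the smaller denominator from the
  other, in numerator and denominator, gives a neighbouring pair with a smaller denominator sum. The
  descent stops only at equal denominators, where the determinant and the bounds force
  \<open>0 / 1\<close> and \<open>1 / 1\<close>.\<close>

lemma farey_pair_on_path:
  fixes p q p' q' :: int
  assumes "p' * q - p * q' = 1" "0 < q" "0 < q'" "0 \<le> p" "p' \<le> q'"
  shows "\<exists>n x. farey x n = (p, q, p', q')"
  using assms
proof (induction "nat (q + q')" arbitrary: p q p' q' rule: less_induct)
  case less
  note det = less.prems(1) and pos = less.prems(2,3) and bds = less.prems(4,5)
  consider "q < q'" | "q = q'" | "q' < q" by linarith
  then show ?case
  proof cases
    case 1
    \<comment> \<open>Here \<open>p' / q'\<close> is the mediant of the parents; it remains to see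
      that the parent \<open>(p' - p) / (q' - q)\<close> does not exceed 1.\<close>
    have d: "(p' - p) * q - p * (q' - q) = 1" using det by (simp add: left_diff_distrib right_diff_distrib)
    have "p' * q \<le> q' * q" using bds pos by (intro mult_right_mono) auto
    then have "p * q' < q * q'" using det mult.commute[of q q'] by linarith
    then have "p < q" using pos mult_less_cancel_right_pos[of q' p q] by blast
    then have "p * (q' - q) \<le> (q - 1) * (q' - q)" using 1 by (intro mult_right_mono) auto
    moreover have "(q' - q + 1) * q - (q - 1) * (q' - q) = q'"
      by (simp add: algebra_simps)
    moreover have "(q' - q + 1) * q \<le> (p' - p) * q" if "\<not> p' - p \<le> q' - q"
      using that pos by (intro mult_right_mono) auto
    ultimately have "p' - p \<le> q' - q" using d 1 pos by linarith
    then obtain n x where nx: "farey x n = (p, q, p' - p, q' - q)"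
      using less.hyps[OF _ d] 1 pos bds by fastforce
    \<comment> \<open>The left end of the parent interval shares its path and lies below the
      mediant, so its next turn is the required left one.\<close>
    define y where "y = lend x n"
    have f: "farey y n = farey x n"
      unfolding y_def using farey_cong[of x n "lend x n"] lend_less_rend by auto
    then have "lend y n = y" by (simp add: y_def lend_def farey_proj_defs)
    then have "\<not> turns_right y n"
      using mediant_between(1)[of y n] by (simp add: turns_right_iff)
    then have "farey y (Suc n) = (lnum y n, lden y n, lnum y n + rnum y n, lden y n + rden y n)"
      using farey_eq[of y "Suc n"] by (simp add: farey_left del: farey.simps)
    then have "farey y (Suc n) = (p, q, p', q')" using f nx by (simp add: farey_proj_defs del: farey.simps)
    then show ?thesis by blast
  next
    case 2
    then have "(p' - p) * q = 1" using det by (simp add: left_diff_distrib)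
    then have "q = 1" "p' - p = 1" using pos by (auto simp: zmult_eq_1_iff)
    then have "farey 0 0 = (p, q, p', q')" using 2 bds by simp
    then show ?thesis by blast
  next
    case 3
    have d: "p' * (q - q') - (p - p') * q' = 1" using det by (simp add: left_diff_distrib right_diff_distrib)
    have "(p + 1) * q \<le> p' * q" if "\<not> p' \<le> p" using that pos by (intro mult_right_mono) auto
    moreover have "(p + 1) * q = p * q + q" by (simp add: algebra_simps)
    moreover have "p * q' \<le> p * q" using bds 3 by (intro mult_left_mono) auto
    ultimately have "p' \<le> p" using det pos 3 by linarith
    then obtain n x where nx: "farey x n = (p - p', q - q', p', q')"
      using less.hyps[OF _ d] 3 pos bds by fastforce
    \<comment> \<open>The mediant of the parent interval shares its path and goes right when
      compared with itself.\<close>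
    define y where "y = mediant_of x n"
    have f: "farey y n = farey x n"
      unfolding y_def using farey_cong[of x n "mediant_of x n"] mediant_between by (auto intro: less_imp_le)
    then have "mediant_of y n = y" by (simp add: y_def mediant_of_def farey_proj_defs)
    then have "turns_right y n" by (simp add: turns_right_iff)
    then have "farey y (Suc n) = (lnum y n + rnum y n, lden y n + rden y n, rnum y n, rden y n)"
      using farey_eq[of y "Suc n"] by (simp add: farey_right del: farey.simps)
    then have "farey y (Suc n) = (p, q, p', q')" using f nx by (simp add: farey_proj_defs del: farey.simps)
    then show ?thesis by blast
  qed
qed

text \<open>Rule induction: the two fractions in the mediant rule are neighbours, hence the ends of
  some path interval, where the values of \<open>qmark\<close> are known. In particular the relation
  is single-valued.\<close>

lemma minkowski_rat_qmark:
  assumes "minkowski_rat r u"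
  shows "0 \<le> r \<and> r \<le> 1 \<and> qmark r = u"
  using assms
proof induction
  case zero
  show ?case using qmark_lend[of 0 0] by (simp add: lend_def)
next
  case one
  show ?case by (simp add: qmark_1)
next
  case (mediant p q p' q' u v)
  have "0 \<le> p" "p' \<le> q'" using mediant by (auto simp: divide_le_eq zero_le_divide_iff)
  then obtain n x where "farey x n = (p, q, p', q')"
    using farey_pair_on_path[of p' q p q'] mediant by auto
  then have e: "lnum x n = p" "lden x n = q" "rnum x n = p'" "rden x n = q'"
    by (simp_all add: farey_proj_defs)
  then have m: "(of_int p + of_int p') / (of_int q + of_int q') = mediant_of x n"
    by (simp add: mediant_of_def)
  have "u = lval x n" "v = lval x n + 1 / 2 ^ n"
    using mediant qmark_lend[of x n] qmark_rend[of x n] by (simp_all add: lend_def rend_def e)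
  then show ?case
    unfolding m using qmark_mediant[of x n] mediant_between[of x n] lend_rend_bounds[of x n]
    by (simp add: add_divide_distrib)
qed

lemma minkowski_rat_ends:
  "minkowski_rat (lend x n) (lval x n)" "minkowski_rat (rend x n) (lval x n + 1 / 2 ^ n)"
proof (induction n)
  case 0
  {
    case 1 show ?case using minkowski_rat.zero by (simp add: lend_def)
  next
    case 2 show ?case using minkowski_rat.one by (simp add: rend_def)
  }
next
  case (Suc n)
  have "minkowski_rat (mediant_of x n) ((lval x n + (lval x n + 1 / 2 ^ n)) / 2)"
    using minkowski_rat.mediant[of "lnum x n" "lden x n" "lval x n" "rnum x n" "rden x n"
        "lval x n + 1 / 2 ^ n"] Suc farey_dens_pos[of x n] farey_det[of x n]
    by (simp add: mediant_of_def lend_def rend_def)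
  then have m: "minkowski_rat (mediant_of x n) (lval x n + 1 / 2 ^ Suc n)"
    by (simp add: field_simps)
  {
    case 1 show ?case using m Suc by (cases "turns_right x n") (simp_all add: ends_steps)
  next
    case 2
    have "lval x n + 1 / 2 ^ Suc n + 1 / 2 ^ Suc n = lval x n + 1 / 2 ^ n" by (simp add: field_simps)
    then show ?case using m Suc(2)
      by (cases "turns_right x n") (simp_all add: ends_steps add.commute add.left_commute)
  }
qed

text \<open>A fraction \<open>a / b\<close> below 1 is the left end of its own path at depth
  \<open>b\<close>: strictly inside an interval it would have \<open>b\<close> at least the sum of
  the two denominators, and that sum exceeds the depth.\<close>

lemma minkowski_rat_total:
  assumes "r \<in> \<rat>" "0 \<le> r" "r \<le> 1"
  shows "minkowski_rat r (qmark r)"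
proof (cases "r = 1")
  case True
  then show ?thesis using minkowski_rat.one by (simp add: qmark_1)
next
  case False
  then have br: "lend r n \<le> r" "r < rend r n" for n using ends_bracket[of r n] assms by auto
  obtain a b :: int where ab: "b > 0" "r = of_int a / of_int b"
    using assms(1) by (metis Rats_cases')
  then have rb: "of_int a = r * of_int b" by simp
  have "lend r (nat b) = r"
  proof (rule ccontr)
    let ?n = "nat b"
    assume "lend r ?n \<noteq> r"
    then have "lend r ?n < r" using br[of ?n] by simp
    then have "real_of_int (lnum r ?n) < r * real_of_int (lden r ?n)"
      using farey_dens_pos[of r ?n] by (simp add: lend_def pos_divide_less_eq)
    then have "real_of_int (lnum r ?n) * real_of_int b < r * real_of_int (lden r ?n) * real_of_int b"
      using ab by (intro mult_strict_right_mono) auto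
    also have "\<dots> = real_of_int (a * lden r ?n)" using rb by (simp add: algebra_simps)
    finally have "real_of_int (lnum r ?n * b) < real_of_int (a * lden r ?n)" by simp
    then have 1: "1 \<le> a * lden r ?n - lnum r ?n * b" by linarith
    have "r * real_of_int (rden r ?n) < real_of_int (rnum r ?n)"
      using br(2)[of ?n] farey_dens_pos[of r ?n] by (simp add: rend_def pos_less_divide_eq)
    then have "r * real_of_int (rden r ?n) * real_of_int b < real_of_int (rnum r ?n) * real_of_int b"
      using ab by (intro mult_strict_right_mono) auto
    moreover have "r * real_of_int (rden r ?n) * real_of_int b = real_of_int (a * rden r ?n)"
      using rb by (simp add: algebra_simps)
    ultimately have "real_of_int (a * rden r ?n) < real_of_int (rnum r ?n * b)" by simp
    then have 2: "1 \<le> rnum r ?n * b - a * rden r ?n" by linarith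
    \<comment> \<open>The two integer gaps, each at least 1, are weighted with the opposite
      denominators; by the determinant condition the result is \<open>b\<close>.\<close>
    have "lden r ?n + rden r ?n \<le> lden r ?n * (rnum r ?n * b - a * rden r ?n)
       + rden r ?n * (a * lden r ?n - lnum r ?n * b)"
      using mult_left_mono[OF 1, of "rden r ?n"] mult_left_mono[OF 2, of "lden r ?n"]
        farey_dens_pos[of r ?n] by linarith
    also have "\<dots> = b * (rnum r ?n * lden r ?n - lnum r ?n * rden r ?n)"
      by (simp add: algebra_simps)
    also have "\<dots> = b" by (simp add: farey_det)
    finally show False using farey_den_sum[of ?n r] ab by simp
  qed
  then show ?thesis using minkowski_rat_ends(1)[of r "nat b"] qmark_lend[of r "nat b"] by simp
qed

lemma the_minkowski_rat:
  assumes "r \<in> \<rat>" "0 \<le> r" "r \<le> 1"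
  shows "(THE y. minkowski_rat r y) = qmark r"
proof (rule the_equality)
  show "minkowski_rat r (qmark r)" by (rule minkowski_rat_total[OF assms])
  show "y = qmark r" if "minkowski_rat r y" for y using minkowski_rat_qmark[OF that] by simp
qed

section \<open>Irrational points and the extension by continuity\<close>

lemma ends_in_Rats: "lend x n \<in> \<rat>" "rend x n \<in> \<rat>"
  by (simp_all add: lend_def rend_def)

lemma ends_strict_bracket:
  assumes "0 \<le> x" "x \<le> 1" "x \<notin> \<rat>"
  shows "lend x n < x" "x < rend x n"
proof -
  have "x \<noteq> 1" using assms(3) by auto
  then have "lend x n \<le> x" "x < rend x n" using ends_bracket[of x n] assms by auto
  moreover have "lend x n \<noteq> x" using assms(3) ends_in_Rats by metis
  ultimately show "lend x n < x" "x < rend x n" by auto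
qed

lemma ends_LIMSEQ:
  assumes "0 \<le> x" "x \<le> 1" "x \<notin> \<rat>"
  shows "lend x \<longlonglongrightarrow> x" "rend x \<longlonglongrightarrow> x"
proof -
  have lim: "(\<lambda>n. 1 / (real n + 1)) \<longlonglongrightarrow> 0"
    using LIMSEQ_inverse_real_of_nat by (simp add: inverse_eq_divide add.commute)
  have "norm (lend x n - x) \<le> 1 / (real n + 1)" "norm (rend x n - x) \<le> 1 / (real n + 1)" for n
    using ends_strict_bracket[OF assms, of n] rend_minus_lend_le[of x n] by auto
  then have "(\<lambda>n. lend x n - x) \<longlonglongrightarrow> 0" "(\<lambda>n. rend x n - x) \<longlonglongrightarrow> 0"
    by (auto intro!: Lim_null_comparison[OF _ lim] always_eventually)
  then show "lend x \<longlonglongrightarrow> x" "rend x \<longlonglongrightarrow> x" by (simp_all add: LIM_zero_iff)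
qed

text \<open>Points close to \<open>x\<close> share its interval of depth \<open>n\<close>, whose
  image has length \<open>1 / 2 ^ n\<close>. This identifies the limit in the definition of
  \<open>minkowski\<close>.\<close>

lemma qmark_isCont:
  assumes "0 \<le> x" "x \<le> 1" "x \<notin> \<rat>"
  shows "isCont qmark x"
  unfolding continuous_at LIM_def
proof (intro allI impI)
  fix e :: real assume "0 < e"
  then obtain n where n: "(1/2) ^ n < e" using real_arch_pow_inv[of e "1/2"] by auto
  define d where "d = min (x - lend x n) (rend x n - x)"
  have "dist (qmark y) (qmark x) < e" if "dist y x < d" for y
  proof -
    have "lend x n \<le> y" "y \<le> rend x n" using that by (auto simp: d_def dist_real_def)
    then have "lval x n \<le> qmark y" "qmark y \<le> lval x n + 1 / 2 ^ n"
      using qmark_mono qmark_lend qmark_rend by metis+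
    then show ?thesis
      using lval_le_qmark[of x n] qmark_le_lval[of x n] n
      by (auto simp: dist_real_def power_one_over)
  qed
  moreover have "0 < d" using ends_strict_bracket[OF assms] by (simp add: d_def)
  ultimately show "\<exists>d>0. \<forall>y. y \<noteq> x \<and> dist y x < d \<longrightarrow> dist (qmark y) (qmark x) < e" by blast
qed

theorem minkowski_eq_qmark:
  assumes "0 \<le> x" "x \<le> 1"
  shows "minkowski x = qmark x"
proof (cases "x \<in> \<rat>")
  case True
  then show ?thesis using the_minkowski_rat assms by (simp add: minkowski_def)
next
  case False
  let ?F = "at x within \<rat> \<inter> {0..1}"
  \<comment> \<open>The left ends are rationals in the unit interval that tend to \<open>x\<close>,
    so the filter is nontrivial and \<open>Lim\<close> denotes the unique limit.\<close>
  have "lend x n \<in> \<rat> \<inter> {0..1} - {x}" for n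
    using ends_in_Rats[of x n] lend_rend_bounds[of x n] lend_less_rend[of x n]
      ends_strict_bracket[OF assms False, of n] assms by auto
  then have "x islimpt \<rat> \<inter> {0..1}"
    using ends_LIMSEQ(1)[OF assms False] unfolding islimpt_sequential by blast
  then have nt: "?F \<noteq> bot" by (simp add: trivial_limit_within)
  have "(qmark \<longlongrightarrow> qmark x) ?F"
    using qmark_isCont[OF assms False] unfolding isCont_def by (rule tendsto_within_subset) simp
  moreover have "\<forall>\<^sub>F r in ?F. qmark r = (THE y. minkowski_rat r y)"
    unfolding eventually_at_filter
    by (rule always_eventually) (simp add: the_minkowski_rat)
  ultimately have "((\<lambda>r. THE y. minkowski_rat r y) \<longlongrightarrow> qmark x) ?F"
    by (rule Lim_transform_eventually)
  then show ?thesis using tendsto_Lim[OF nt] False by (simp add: minkowski_def)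
qed

section \<open>Difference quotients along the Farey path\<close>

lemma quotient_bounds:
  fixes h d A B c e :: real
  assumes "0 < h" "h \<le> 1 / A" "1 / B \<le> h" "0 < A" "0 < B" "0 \<le> c" "c \<le> d" "d \<le> e"
  shows "A * c \<le> d / h" "d / h \<le> B * e"
proof -
  have "A * h \<le> 1" "1 \<le> B * h" using assms by (simp_all add: field_simps)
  then have "A * h * c \<le> 1 * c" "1 * e \<le> B * h * e"
    using assms by (simp_all only: mult_right_mono order.trans)
  then have "A * c * h \<le> d" "d \<le> B * e * h" using assms by (simp_all add: algebra_simps)
  then show "A * c \<le> d / h" "d / h \<le> B * e"
    using assms(1) by (simp_all only: pos_le_divide_eq pos_divide_le_eq)
qed

text \<open>The point \<open>y\<close> drops out of the path intervals after depth \<open>n\<close>,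
  so the interval of depth \<open>n\<close> gives both upper bounds. At a later left turn
  \<open>i\<close> the right end moves from \<open>rend x i\<close> to
  \<open>rend x (Suc i)\<close>, all between \<open>x\<close> and \<open>y\<close>; the length of
  this move and the length \<open>1 / 2 ^ Suc i\<close> of its image give the lower bounds.\<close>

lemma slope_bounds_right:
  assumes x: "0 \<le> x" "x \<le> 1" "x \<notin> \<rat>"
    and y: "rend x (Suc n) < y" "y \<le> rend x n" and i: "n < i" "\<not> turns_right x i"
  shows "of_int (lden x n) * of_int (rden x n) * (1 / 2 ^ Suc i) \<le> (qmark y - qmark x) / (y - x)"
    "(qmark y - qmark x) / (y - x) \<le> of_int (rden x i) * of_int (rden x (Suc i)) * (1 / 2 ^ n)"
proof -
  note br = ends_strict_bracket[OF x]
  have ri: "rend x i \<le> rend x (Suc n)" using i by (intro rend_antimono) simp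
  have lo: "1 / 2 ^ Suc i \<le> qmark y - qmark x"
  proof -
    have "qmark x \<le> qmark (rend x (Suc i))" "qmark (rend x i) \<le> qmark y"
      using br[of "Suc i"] ri y by (auto intro: qmark_mono)
    moreover have "qmark (rend x i) - qmark (rend x (Suc i)) = 1 / 2 ^ Suc i"
      using i by (simp add: qmark_rend field_simps)
    ultimately show ?thesis by linarith
  qed
  have up: "qmark y - qmark x \<le> 1 / 2 ^ n"
    using qmark_mono[OF y(2)] lval_le_qmark[of x n] by (simp add: qmark_rend)
  have h: "y - x \<le> 1 / (of_int (lden x n) * of_int (rden x n))"
    using y br[of n] rend_minus_lend[of x n] by simp
  have "rend x i - rend x (Suc i) = 1 / (of_int (rden x i) * of_int (rden x (Suc i)))"
    using rend_minus_mediant[of x i] i by (simp add: ends_left farey_left)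
  then have h': "1 / (of_int (rden x i) * of_int (rden x (Suc i))) \<le> y - x"
    using y ri br[of "Suc i"] by simp
  have "0 < y - x" using y br[of "Suc n"] by simp
  from quotient_bounds[OF this h h' _ _ _ lo up] farey_dens_pos
  show "of_int (lden x n) * of_int (rden x n) * (1 / 2 ^ Suc i) \<le> (qmark y - qmark x) / (y - x)"
    "(qmark y - qmark x) / (y - x) \<le> of_int (rden x i) * of_int (rden x (Suc i)) * (1 / 2 ^ n)"
    by simp_all
qed

text \<open>Mirror image of \<open>slope_bounds_right\<close>: the left end moves at the right turn
  \<open>i\<close>.\<close>

lemma slope_bounds_left:
  assumes x: "0 \<le> x" "x \<le> 1" "x \<notin> \<rat>"
    and y: "y < lend x (Suc n)" "lend x n \<le> y" and i: "n < i" "turns_right x i"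
  shows "of_int (lden x n) * of_int (rden x n) * (1 / 2 ^ Suc i) \<le> (qmark y - qmark x) / (y - x)"
    "(qmark y - qmark x) / (y - x) \<le> of_int (lden x i) * of_int (lden x (Suc i)) * (1 / 2 ^ n)"
proof -
  note br = ends_strict_bracket[OF x]
  have li: "lend x (Suc n) \<le> lend x i" using i by (intro lend_mono) simp
  have lo: "1 / 2 ^ Suc i \<le> qmark x - qmark y"
  proof -
    have "qmark (lend x (Suc i)) \<le> qmark x" "qmark y \<le> qmark (lend x i)"
      using br[of "Suc i"] li y by (auto intro: qmark_mono)
    moreover have "qmark (lend x (Suc i)) - qmark (lend x i) = 1 / 2 ^ Suc i"
      using i by (simp add: qmark_lend)
    ultimately show ?thesis by linarith
  qed
  have up: "qmark x - qmark y \<le> 1 / 2 ^ n"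
    using qmark_mono[OF y(2)] qmark_le_lval[of x n] by (simp add: qmark_lend)
  have h: "x - y \<le> 1 / (of_int (lden x n) * of_int (rden x n))"
    using y br[of n] rend_minus_lend[of x n] by simp
  have "lend x (Suc i) - lend x i = 1 / (of_int (lden x i) * of_int (lden x (Suc i)))"
    using mediant_minus_lend[of x i] i by (simp add: ends_right farey_right)
  then have h': "1 / (of_int (lden x i) * of_int (lden x (Suc i))) \<le> x - y"
    using y li br[of "Suc i"] by simp
  have "0 < x - y" using y br[of "Suc n"] by simp
  moreover have "(qmark y - qmark x) / (y - x) = (qmark x - qmark y) / (x - y)"
    using minus_divide_divide[of "qmark x - qmark y" "x - y"] by simp
  ultimately show
    "of_int (lden x n) * of_int (rden x n) * (1 / 2 ^ Suc i) \<le> (qmark y - qmark x) / (y - x)"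
    "(qmark y - qmark x) / (y - x) \<le> of_int (lden x i) * of_int (lden x (Suc i)) * (1 / 2 ^ n)"
    using quotient_bounds[OF _ h h' _ _ _ lo up] farey_dens_pos by simp_all
qed

text \<open>Gives the depth at which \<open>y\<close> leaves the path intervals; \<open>f\<close>
  will be the sequence of right ends or of negated left ends.\<close>

lemma crossing_index:
  fixes f :: "nat \<Rightarrow> real"
  assumes "f \<longlonglongrightarrow> x" "x < y" "y \<le> f k"
  obtains n where "k \<le> n" "y \<le> f n" "f (Suc n) < y"
proof -
  have "\<forall>\<^sub>F n in sequentially. f n < y" using order_tendstoD(2)[OF assms(1,2)] .
  then obtain N where N: "f n < y" if "N \<le> n" for n unfolding eventually_sequentially by blast
  have "\<exists>n\<ge>k. y \<le> f n \<and> f (Suc n) < y"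
  proof (rule ccontr)
    assume *: "\<not> ?thesis"
    have "y \<le> f (k + j)" for j
    proof (induction j)
      case (Suc j)
      then show ?case using * by (metis add_Suc_right le_add1 not_le)
    qed (use assms in simp)
    then show False using N[of "k + N"] by (meson le_add2 not_le)
  qed
  then show ?thesis using that by blast
qed

section \<open>Infinite continued fractions\<close>

definition pos_seq :: "(nat \<Rightarrow> nat) \<Rightarrow> bool" where "pos_seq a \<longleftrightarrow> (\<forall>i\<ge>1. 0 < a i)"

definition cfrac_lim :: "(nat \<Rightarrow> nat) \<Rightarrow> real" where "cfrac_lim a = lim (cfrac_fin a)"

lemma pos_seqD: "pos_seq a \<Longrightarrow> 1 \<le> i \<Longrightarrow> 1 \<le> a i"
  by (simp add: pos_seq_def Suc_le_eq)

lemma pos_seq_shift: "pos_seq a \<Longrightarrow> pos_seq (\<lambda>i. a (i + k))"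
  by (simp add: pos_seq_def)

lemma cfrac_fin_bounds:
  assumes "pos_seq a"
  shows "0 \<le> cfrac_fin a n \<and> cfrac_fin a n \<le> 1"
  using assms
proof (induction n arbitrary: a)
  case (Suc n)
  have "0 \<le> cfrac_fin (\<lambda>i. a (i + 1)) n" using Suc.IH[OF pos_seq_shift[OF Suc.prems]] by blast
  then have "1 \<le> real (a 1) + cfrac_fin (\<lambda>i. a (i + 1)) n"
    using pos_seqD[OF Suc.prems, of 1] by (simp add: add_increasing2)
  then show ?case by simp
qed simp

text \<open>The values are \<open>(b + u) / s\<close> and \<open>(b + v) / t\<close>, images under a
  Moebius map of determinant 1, so they differ by \<open>(u - v) / (s * t)\<close> with
  \<open>s\<close> and \<open>t\<close> at least 2. One level \<open>1 / (b + u)\<close> alone has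
  no uniform contraction factor below 1.\<close>

lemma two_step_contraction:
  fixes a b u v :: real
  assumes "1 \<le> a" "1 \<le> b" "0 \<le> u" "0 \<le> v"
  shows "\<bar>1 / (a + 1 / (b + u)) - 1 / (a + 1 / (b + v))\<bar> \<le> \<bar>u - v\<bar> / 4"
proof -
  define s where "s = a * (b + u) + 1"
  define t where "t = a * (b + v) + 1"
  have "1 * 1 \<le> a * (b + u)" "1 * 1 \<le> a * (b + v)" by (intro mult_mono; use assms in simp)+
  then have st: "2 \<le> s" "2 \<le> t" by (simp_all add: s_def t_def)
  have "a + 1 / (b + w) = (a * (b + w) + 1) / (b + w)" if "0 \<le> w" for w
    using that assms by (simp add: add_divide_eq_iff)
  then have f: "1 / (a + 1 / (b + u)) = (b + u) / s" "1 / (a + 1 / (b + v)) = (b + v) / t"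
    using assms by (simp_all add: s_def t_def)
  have "s \<noteq> 0" "t \<noteq> 0" using st by auto
  then have "1 / (a + 1 / (b + u)) - 1 / (a + 1 / (b + v)) = ((b + u) * t - (b + v) * s) / (s * t)"
    unfolding f by (rule diff_frac_eq)
  also have "(b + u) * t - (b + v) * s = u - v" by (simp add: s_def t_def algebra_simps)
  finally have e: "\<bar>1 / (a + 1 / (b + u)) - 1 / (a + 1 / (b + v))\<bar> = \<bar>u - v\<bar> / (s * t)"
    using st by (simp add: abs_mult)
  have "2 * 2 \<le> s * t" using st by (intro mult_mono) auto
  then show ?thesis unfolding e by (intro divide_left_mono) auto
qed

text \<open>Induction in steps of two: peeling off two partial quotients gains the factor 1/4, that
  is 1/2 per step.\<close>

lemma cfrac_fin_diff:
  assumes "pos_seq a"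
  shows "\<bar>cfrac_fin a (Suc n) - cfrac_fin a n\<bar> \<le> 2 * (1 / 2) ^ n"
  using assms
proof (induction n arbitrary: a rule: induct_nat_012)
  case 0
  then show ?case using cfrac_fin_bounds[OF 0, of "Suc 0"] by auto
next
  case 1
  then show ?case
    using cfrac_fin_bounds[OF 1, of "Suc 0"] cfrac_fin_bounds[OF 1, of "Suc (Suc 0)"]
    by (auto simp: abs_le_iff simp del: cfrac_fin.simps)
next
  case (ge2 n)
  let ?b = "\<lambda>i. a (i + 2)"
  have b: "pos_seq ?b" by (rule pos_seq_shift) (rule ge2.prems)
  have s: "cfrac_fin a (Suc (Suc m)) = 1 / (real (a 1) + 1 / (real (a 2) + cfrac_fin ?b m))" for m
    by (simp add: numeral_2_eq_2)
  have "\<bar>cfrac_fin a (Suc (Suc (Suc n))) - cfrac_fin a (Suc (Suc n))\<bar>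
      \<le> \<bar>cfrac_fin ?b (Suc n) - cfrac_fin ?b n\<bar> / 4"
    unfolding s using pos_seqD[OF ge2.prems, of 1] pos_seqD[OF ge2.prems, of 2] cfrac_fin_bounds[OF b]
    by (intro two_step_contraction) (simp_all del: cfrac_fin.simps)
  also have "\<dots> \<le> (2 * (1 / 2) ^ n) / 4" using ge2.IH(1)[OF b] by simp
  finally show ?case by (simp add: field_simps del: cfrac_fin.simps)
qed

lemma cfrac_fin_LIMSEQ:
  assumes "pos_seq a"
  shows "cfrac_fin a \<longlonglongrightarrow> cfrac_lim a"
proof -
  have "summable (\<lambda>n. 2 * (1 / 2 :: real) ^ n)"
    by (intro summable_mult summable_geometric) simp
  then have "summable (\<lambda>n. cfrac_fin a (Suc n) - cfrac_fin a n)"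
    by (rule summable_comparison_test'[where N = 0])
      (use cfrac_fin_diff[OF assms] in \<open>simp del: cfrac_fin.simps\<close>)
  then have "(\<lambda>n. \<Sum>k<n. cfrac_fin a (Suc k) - cfrac_fin a k) \<longlonglongrightarrow>
      (\<Sum>k. cfrac_fin a (Suc k) - cfrac_fin a k)"
    by (rule summable_LIMSEQ)
  then have "cfrac_fin a \<longlonglongrightarrow> (\<Sum>k. cfrac_fin a (Suc k) - cfrac_fin a k)"
    by (simp add: sum_lessThan_telescope del: cfrac_fin.simps(2))
  then show ?thesis unfolding cfrac_lim_def by (simp add: limI)
qed

lemma cfrac_lim_bounds_weak:
  assumes "pos_seq a"
  shows "0 \<le> cfrac_lim a" "cfrac_lim a \<le> 1"
  using LIMSEQ_le_const[OF cfrac_fin_LIMSEQ[OF assms]] LIMSEQ_le_const2[OF cfrac_fin_LIMSEQ[OF assms]]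
    cfrac_fin_bounds[OF assms] by blast+

lemma cfrac_lim_step:
  assumes "pos_seq a"
  shows "cfrac_lim a = 1 / (real (a 1) + cfrac_lim (\<lambda>i. a (i + 1)))"
proof -
  let ?b = "\<lambda>i. a (i + 1)"
  have b: "pos_seq ?b" by (rule pos_seq_shift) (rule assms)
  have "(\<lambda>n. 1 / (real (a 1) + cfrac_fin ?b n)) \<longlonglongrightarrow> 1 / (real (a 1) + cfrac_lim ?b)"
    using pos_seqD[OF assms, of 1] cfrac_lim_bounds_weak[OF b]
    by (intro tendsto_intros cfrac_fin_LIMSEQ[OF b]) simp
  then have "(\<lambda>n. cfrac_fin a (Suc n)) \<longlonglongrightarrow> 1 / (real (a 1) + cfrac_lim ?b)" by simp
  moreover have "(\<lambda>n. cfrac_fin a (Suc n)) \<longlonglongrightarrow> cfrac_lim a"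
    using cfrac_fin_LIMSEQ[OF assms] by (rule LIMSEQ_Suc)
  ultimately show ?thesis by (rule LIMSEQ_unique[symmetric])
qed

lemma cfrac_lim_pos:
  assumes "pos_seq a"
  shows "0 < cfrac_lim a"
  using cfrac_lim_step[OF assms] pos_seqD[OF assms, of 1]
    cfrac_lim_bounds_weak[OF pos_seq_shift[OF assms, of 1]]
  by (simp add: add_pos_nonneg)

lemma cfrac_lim_inverse:
  assumes "pos_seq a"
  shows "1 / cfrac_lim a = real (a 1) + cfrac_lim (\<lambda>i. a (i + 1))"
  by (subst cfrac_lim_step[OF assms]) simp

lemma cfrac_lim_less_1:
  assumes "pos_seq a"
  shows "cfrac_lim a < 1"
proof -
  have "1 < 1 / cfrac_lim a"
    using cfrac_lim_inverse[OF assms] pos_seqD[OF assms, of 1]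
      cfrac_lim_pos[OF pos_seq_shift[OF assms, of 1]] by simp
  then show ?thesis using cfrac_lim_pos[OF assms] by (simp add: field_simps)
qed

text \<open>Infinite descent: inverting \<open>c / d\<close> and subtracting the first partial
  quotient leaves a fraction with the smaller denominator \<open>c\<close>.\<close>

lemma cfrac_lim_not_fraction:
  fixes c d :: int
  assumes "pos_seq a" "0 < d"
  shows "cfrac_lim a \<noteq> of_int c / of_int d"
  using assms
proof (induction "nat d" arbitrary: a c d rule: less_induct)
  case less
  show ?case
  proof
    assume e: "cfrac_lim a = of_int c / of_int d"
    have c: "0 < c" "c < d"
      using cfrac_lim_pos[OF less.prems(1)] cfrac_lim_less_1[OF less.prems(1)] less.prems(2)
      by (simp_all add: e zero_less_divide_iff)
    have "cfrac_lim (\<lambda>i. a (i + 1)) = of_int (d - int (a 1) * c) / of_int c"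
      using cfrac_lim_inverse[OF less.prems(1)] c by (simp add: e field_simps)
    moreover have "nat c < nat d" using c by simp
    ultimately show False using less.hyps pos_seq_shift[OF less.prems(1)] c(1) by blast
  qed
qed

lemma cfrac_lim_irrational:
  assumes "pos_seq a"
  shows "cfrac_lim a \<notin> \<rat>"
  using cfrac_lim_not_fraction[OF assms] by (metis Rats_cases')

lemma is_cfrac_iff: "is_cfrac x a \<longleftrightarrow> pos_seq a \<and> x = cfrac_lim a"
  unfolding is_cfrac_def pos_seq_def[symmetric]
  using cfrac_fin_LIMSEQ LIMSEQ_unique by blast

section \<open>The Farey path of a continued fraction\<close>

text \<open>The recurrence for the denominators of the convergents; the separate case
  \<open>Suc 0\<close> replaces the customary start with denominator 0 at index -1.\<close>

fun cden :: "(nat \<Rightarrow> nat) \<Rightarrow> nat \<Rightarrow> nat" where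
  "cden a 0 = 1"
| "cden a (Suc 0) = a 1"
| "cden a (Suc (Suc n)) = a (Suc (Suc n)) * cden a (Suc n) + cden a n"

definition psum :: "(nat \<Rightarrow> nat) \<Rightarrow> nat \<Rightarrow> nat" where "psum a t = (\<Sum>i=1..t. a i)"

lemma psum_0 [simp]: "psum a 0 = 0"
  and psum_Suc [simp]: "psum a (Suc t) = psum a t + a (Suc t)"
  by (simp_all add: psum_def)

lemma psum_less:
  assumes "pos_seq a"
  shows "psum a t < psum a (Suc t)"
  using pos_seqD[OF assms, of "Suc t"] by simp

lemma psum_strict_mono:
  assumes "pos_seq a"
  shows "strict_mono (psum a)"
  using psum_less[OF assms] by (simp add: strict_mono_Suc_iff)

lemma cden_mono:
  assumes "pos_seq a" "s \<le> t"
  shows "cden a s \<le> cden a t"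
proof (rule lift_Suc_mono_le[OF _ assms(2), of "cden a"])
  show "cden a n \<le> cden a (Suc n)" for n
  proof (cases n)
    case 0
    then show ?thesis using pos_seqD[OF assms(1), of 1] by simp
  next
    case (Suc m)
    have "cden a n \<le> a (Suc n) * cden a n"
      using pos_seqD[OF assms(1), of "Suc n"] by (cases "a (Suc n)") auto
    also have "\<dots> \<le> cden a (Suc n)" using Suc by simp
    finally show ?thesis .
  qed
qed

text \<open>The flag \<open>s\<close> is the direction of a run of turns, true for right: right
  turns keep the right denominator fixed, left turns the left one.\<close>

definition side_den :: "real \<Rightarrow> bool \<Rightarrow> nat \<Rightarrow> int" where
  "side_den x s n = (if s then rden x n else lden x n)"

text \<open>
  The position of \<open>x\<close> inside its Farey interval, normalised by a projective map that sends the
  ends to 0 and infinity and the mediant to 1; the right end goes to infinity if \<open>s\<close> holds, the left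
  end otherwise. As long as it exceeds 1, a path step subtracts 1 from it, so that the path runs the
  additive Euclidean algorithm.
\<close>

definition side_ratio :: "real \<Rightarrow> bool \<Rightarrow> nat \<Rightarrow> real" where
  "side_ratio x s n =
    (let l = x * of_int (lden x n) - of_int (lnum x n); r = of_int (rnum x n) - x * of_int (rden x n)
     in if s then l / r else r / l)"

lemma side_ratio_Not: "side_ratio x (\<not> s) n = 1 / side_ratio x s n"
  by (simp add: side_ratio_def Let_def)

lemma side_step:
  assumes x: "0 \<le> x" "x \<le> 1" "x \<notin> \<rat>" and r: "1 < side_ratio x s n"
  shows "turns_right x n = s" "side_den x s (Suc n) = side_den x s n"
    "side_den x (\<not> s) (Suc n) = side_den x (\<not> s) n + side_den x s n"
    "side_ratio x s (Suc n) = side_ratio x s n - 1"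
proof -
  \<comment> \<open>The distances of \<open>x\<close> from the two ends, scaled by the denominators.
    A right turn replaces \<open>L\<close> by \<open>L - R\<close>, a left turn \<open>R\<close> by
    \<open>R - L\<close>.\<close>
  define L where "L = x * of_int (lden x n) - of_int (lnum x n)"
  define R where "R = of_int (rnum x n) - x * of_int (rden x n)"
  have pos: "0 < L" "0 < R"
    using ends_strict_bracket[OF x, of n] farey_dens_pos[of x n]
    by (simp_all add: L_def R_def lend_def rend_def pos_divide_less_eq pos_less_divide_eq)
  have t: "turns_right x n \<longleftrightarrow> R \<le> L"
    by (auto simp: turns_right_def L_def R_def algebra_simps)
  show s: "turns_right x n = s"
    using r pos unfolding t by (cases s) (simp_all add: side_ratio_def flip: L_def R_def)
  show "side_den x s (Suc n) = side_den x s n"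
    "side_den x (\<not> s) (Suc n) = side_den x (\<not> s) n + side_den x s n"
    using s by (cases s; simp add: side_den_def farey_steps)+
  show "side_ratio x s (Suc n) = side_ratio x s n - 1"
  proof (cases s)
    case True
    then have "side_ratio x s (Suc n) = (L - R) / R"
      using s by (simp add: side_ratio_def farey_right L_def R_def algebra_simps)
    then show ?thesis using True pos by (simp add: side_ratio_def diff_divide_distrib flip: L_def R_def)
  next
    case False
    then have "side_ratio x s (Suc n) = (R - L) / L"
      using s by (simp add: side_ratio_def farey_left L_def R_def algebra_simps)
    then show ?thesis using False pos by (simp add: side_ratio_def diff_divide_distrib flip: L_def R_def)
  qed
qed

text \<open>Each turn lowers the ratio by 1, and it exceeds 1 as long as fewer than \<open>k\<close>
  turns are made, because \<open>z\<close> is positive. Adding the fixed denominator to the other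
  one \<open>k\<close> times imitates the recurrence of \<open>cden\<close>.\<close>

lemma side_run:
  assumes x: "0 \<le> x" "x \<le> 1" "x \<notin> \<rat>" and r: "side_ratio x s n = real k + z" and z: "0 < z"
    and j: "j \<le> k"
  shows "(j < k \<longrightarrow> turns_right x (n + j) = s) \<and> side_den x s (n + j) = side_den x s n \<and>
    side_den x (\<not> s) (n + j) = side_den x (\<not> s) n + int j * side_den x s n \<and>
    side_ratio x s (n + j) = real (k - j) + z"
  using j
proof (induction j)
  case 0
  show ?case using side_step(1)[OF x, of s n] r z by auto
next
  case (Suc j)
  then have "1 < side_ratio x s (n + j)" using z by simp
  note st = side_step[OF x this]
  have "1 < side_ratio x s (Suc (n + j))" if "Suc j < k"
    using st(4) Suc that z by simp
  then have "Suc j < k \<longrightarrow> turns_right x (Suc (n + j)) = s" using side_step(1)[OF x] by blast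
  then show ?case using Suc st by (simp add: algebra_simps)
qed

section \<open>Blocks of equal turns on the path of a continued fraction\<close>

context
  fixes a :: "nat \<Rightarrow> nat" and x :: real
  assumes a: "pos_seq a" and x_def: "x = cfrac_lim a"
begin

lemma unit_irrational: "0 \<le> x" "x \<le> 1" "x \<notin> \<rat>"
  unfolding x_def using cfrac_lim_bounds_weak[OF a] cfrac_lim_irrational[OF a] by auto

lemma block_run:
  assumes "side_ratio x s n = 1 / cfrac_lim (\<lambda>i. a (i + t))" "j \<le> a (Suc t)"
  shows "(j < a (Suc t) \<longrightarrow> turns_right x (n + j) = s) \<and> side_den x s (n + j) = side_den x s n \<and>
    side_den x (\<not> s) (n + j) = side_den x (\<not> s) n + int j * side_den x s n \<and>
    side_ratio x s (n + j) = real (a (Suc t) - j) + cfrac_lim (\<lambda>i. a (i + Suc t))"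
proof (rule side_run[OF unit_irrational])
  show "side_ratio x s n = real (a (Suc t)) + cfrac_lim (\<lambda>i. a (i + Suc t))"
    using cfrac_lim_inverse[OF pos_seq_shift[OF a, of t]] assms(1) by simp
  show "0 < cfrac_lim (\<lambda>i. a (i + Suc t))" by (rule cfrac_lim_pos[OF pos_seq_shift[OF a]])
qed (rule assms)

text \<open>Block \<open>t\<close> begins at depth \<open>psum a t - 1\<close>, since the start in
  the unit interval already accounts for one unit of \<open>a 1\<close>. At the end of a block the
  ratio is the next tail, below 1; seen from the other side it is inverted and starts a run in the
  opposite direction, hence the parities.\<close>

lemma block_start:
  assumes "1 \<le> t" "Suc n = psum a t"
  shows "side_den x (odd t) n = int (cden a t) \<and> side_den x (even t) n = int (cden a (t - 1)) \<and>
    side_ratio x (odd t) n = 1 / cfrac_lim (\<lambda>i. a (i + t))"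
  using assms
proof (induction t arbitrary: n rule: nat_induct_at_least)
  case base
  have a1: "a 1 = Suc n" using base by simp
  \<comment> \<open>At depth 0 the ratio for left turns is \<open>1 / x - 1\<close>, so the path
    opens with \<open>a 1 - 1\<close> left turns.\<close>
  have "side_ratio x False 0 = real n + cfrac_lim (\<lambda>i. a (i + 1))"
    using cfrac_lim_inverse[OF a] a1 cfrac_lim_pos[OF a]
    by (simp add: side_ratio_def x_def diff_divide_distrib)
  from side_run[OF unit_irrational this, of n] cfrac_lim_pos[OF pos_seq_shift[OF a, of 1]]
  show ?case
    using a1 side_ratio_Not[of x False n] by (simp add: side_den_def)
next
  case (Suc t)
  define m where "m = psum a t - 1"
  have "1 \<le> psum a t" using Suc.hyps pos_seqD[OF a, of t] by (cases t) auto
  then have m: "Suc m = psum a t" by (simp add: m_def)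
  then have n: "n = m + a (Suc t)" using Suc.prems by simp
  note IH = Suc.IH[OF m]
  then have "side_den x (odd t) n = side_den x (odd t) m"
    "side_den x (\<not> odd t) n = side_den x (\<not> odd t) m + int (a (Suc t)) * side_den x (odd t) m"
    "side_ratio x (odd t) n = cfrac_lim (\<lambda>i. a (i + Suc t))"
    using block_run[of "odd t" m t "a (Suc t)"] unfolding n by auto
  moreover have "cden a (Suc t) = a (Suc t) * cden a t + cden a (t - 1)"
    using Suc.hyps by (cases t) auto
  ultimately show ?case using IH side_ratio_Not[of x "odd t" n] by simp
qed

lemma block_turns:
  assumes "1 \<le> t" "psum a t \<le> Suc n" "Suc n < psum a (Suc t)"
  shows "turns_right x n = odd t"
proof -
  define m where "m = psum a t - 1"
  have "1 \<le> psum a t" using assms(1) pos_seqD[OF a, of t] by (cases t) auto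
  then have m: "Suc m = psum a t" by (simp add: m_def)
  then obtain j where j: "n = m + j" "j < a (Suc t)"
    using assms by (metis (no_types, opaque_lifting) Suc_le_mono add_Suc le_Suc_ex nat_add_left_cancel_less psum_Suc)
  then show ?thesis using block_run[of "odd t" m t j] block_start[OF assms(1) m] by simp
qed

lemma block_dens_prod:
  assumes "1 \<le> t" "Suc n = psum a t"
  shows "lden x n * rden x n = int (cden a t * cden a (t - 1))"
  using block_start[OF assms] by (cases "odd t") (auto simp: side_den_def)

lemma block_dens_le:
  assumes "1 \<le> t" "Suc n \<le> psum a t"
  shows "lden x n \<le> int (cden a t)" "rden x n \<le> int (cden a t)"
proof -
  define m where "m = psum a t - 1"
  have m: "Suc m = psum a t" "n \<le> m" using assms by (auto simp: m_def)
  have "lden x m \<le> int (cden a t)" "rden x m \<le> int (cden a t)"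
    using block_start[OF assms(1) m(1)] cden_mono[OF a, of "t - 1" t]
    by (cases "odd t"; auto simp: side_den_def)+
  then show "lden x n \<le> int (cden a t)" "rden x n \<le> int (cden a t)"
    using lden_mono[OF m(2)] rden_mono[OF m(2)] by (meson order.trans)+
qed

lemma block_index:
  obtains t where "psum a t \<le> n" "n < psum a (Suc t)"
proof -
  have "\<exists>t. psum a t \<le> n \<and> n < psum a (Suc t)"
  proof (rule ccontr)
    assume *: "\<not> ?thesis"
    have "psum a t \<le> n" for t
      by (induction t) (use * in \<open>auto simp: not_less\<close>)
    moreover have "Suc n \<le> psum a (Suc n)"
      using psum_strict_mono[OF a] by (rule strict_mono_imp_increasing)
    ultimately show False by (meson not_less_eq_eq)
  qed
  then show ?thesis using that by blast
qed

lemma qmark_slope_bounds: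
  assumes "1 \<le> t0"
  shows "\<forall>\<^sub>F y in at x. \<exists>t\<ge>t0.
    real (cden a t) * real (cden a (t - 1)) / 2 ^ psum a (t + 2) \<le> (qmark y - qmark x) / (y - x) \<and>
    (qmark y - qmark x) / (y - x) \<le> 2 * (real (cden a (t + 3)))\<^sup>2 / 2 ^ psum a t"
proof -
  let ?n0 = "psum a t0"
  \<comment> \<open>Both sides of \<open>x\<close> are treated at once: the turn at \<open>n\<close>
    tells on which side \<open>y\<close> leaves, and \<open>lo\<close> and \<open>up\<close> are the
    conclusions of \<open>slope_bounds_right\<close> or \<open>slope_bounds_left\<close>.\<close>
  have core: "\<exists>t\<ge>t0.
      real (cden a t) * real (cden a (t - 1)) / 2 ^ psum a (t + 2) \<le> D \<and>
      D \<le> 2 * (real (cden a (t + 3)))\<^sup>2 / 2 ^ psum a t"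
    if n: "?n0 \<le> n" and
      lo: "\<And>i. n < i \<Longrightarrow> turns_right x i = turns_right x n \<Longrightarrow>
        of_int (lden x n) * of_int (rden x n) * (1 / 2 ^ Suc i) \<le> D" and
      up: "\<And>i. n < i \<Longrightarrow> turns_right x i = turns_right x n \<Longrightarrow>
        D \<le> of_int (side_den x (\<not> turns_right x n) i) *
             of_int (side_den x (\<not> turns_right x n) (Suc i)) * (1 / 2 ^ n)" for n D
  proof -
    obtain t where t: "psum a t \<le> Suc n" "Suc n < psum a (Suc t)" by (rule block_index)
    have "psum a t0 < psum a (Suc t)" using n t by simp
    then have tt: "t0 \<le> t" by (simp add: strict_mono_less[OF psum_strict_mono[OF a]] del: psum_Suc)
    then have t1: "1 \<le> t" using assms by simp
    \<comment> \<open>The first depth of block \<open>t + 2\<close>, where the direction of block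
      \<open>t\<close> returns; \<open>Suc i\<close> is the exponent in the lower bound.\<close>
    define i where "i = psum a (t + 2) - 1"
    have "Suc n < psum a (t + 2)" using t psum_less[OF a, of "Suc t"] by simp
    then have i: "Suc i = psum a (t + 2)" "n < i" by (auto simp: i_def)
    have i3: "Suc (Suc i) \<le> psum a (t + 3)"
      using i psum_less[OF a, of "t + 2"] by (simp add: eval_nat_numeral)
    have "turns_right x i = odd (t + 2)" using i i3 t1 by (intro block_turns) (auto simp: eval_nat_numeral)
    moreover have "turns_right x n = odd t" using t t1 by (intro block_turns)
    ultimately have same: "turns_right x i = turns_right x n" by simp
    \<comment> \<open>At the first depth \<open>m\<close> of block \<open>t\<close> the product of
      the denominators is known, and it can only grow from there to \<open>n\<close>.\<close>
    define m where "m = psum a t - 1"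
    have "1 \<le> psum a t" using t1 pos_seqD[OF a, of t] by (cases t) auto
    then have m: "Suc m = psum a t" "m \<le> n" using t by (auto simp: m_def)
    have "int (cden a t * cden a (t - 1)) \<le> lden x n * rden x n"
      unfolding block_dens_prod[OF t1 m(1), symmetric]
      using lden_mono[OF m(2)] rden_mono[OF m(2)] farey_dens_pos[of x]
      by (intro mult_mono) (auto intro: less_imp_le)
    then have "real_of_int (int (cden a t * cden a (t - 1))) \<le> real_of_int (lden x n * rden x n)"
      by (simp only: of_int_le_iff)
    then have "real (cden a t) * real (cden a (t - 1)) * (1 / 2 ^ Suc i)
        \<le> of_int (lden x n) * of_int (rden x n) * (1 / 2 ^ Suc i)"
      by (intro mult_right_mono) auto
    also have "\<dots> \<le> D" by (rule lo[OF i(2) same])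
    finally have 1: "real (cden a t) * real (cden a (t - 1)) / 2 ^ psum a (t + 2) \<le> D"
      by (simp only: i(1) times_divide_eq_right mult_1_right)
    have "side_den x b i \<le> int (cden a (t + 3))" "side_den x b (Suc i) \<le> int (cden a (t + 3))" for b
      using block_dens_le[of "t + 3" i] block_dens_le[of "t + 3" "Suc i"] i3
      by (simp_all add: side_den_def)
    then have sd: "real_of_int (side_den x b i) \<le> real (cden a (t + 3))"
      "real_of_int (side_den x b (Suc i)) \<le> real (cden a (t + 3))" for b
      by (metis of_int_le_iff of_int_of_nat_eq)+
    have nn: "0 \<le> real_of_int (side_den x b j)" for b j
      using farey_dens_pos[of x j] by (simp add: side_den_def)
    \<comment> \<open>The exit depth can be as small as \<open>psum a t - 1\<close>, which costs the
      factor 2.\<close>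
    have pw: "1 / 2 ^ n \<le> 2 / (2::real) ^ psum a t"
    proof -
      have "(2::real) ^ psum a t \<le> 2 ^ Suc n" using t by (intro power_increasing) auto
      then show ?thesis by (simp add: field_simps)
    qed
    have "D \<le> of_int (side_den x (\<not> turns_right x n) i) *
        of_int (side_den x (\<not> turns_right x n) (Suc i)) * (1 / 2 ^ n)"
      by (rule up[OF i(2) same])
    also have "\<dots> \<le> real (cden a (t + 3)) * real (cden a (t + 3)) * (2 / 2 ^ psum a t)"
      using sd nn pw by (intro mult_mono) auto
    finally have "D \<le> 2 * (real (cden a (t + 3)))\<^sup>2 / 2 ^ psum a t"
      by (simp add: power2_eq_square mult_ac)
    then show ?thesis using 1 tt by blast
  qed
  note lims = ends_LIMSEQ[OF unit_irrational] and br = ends_strict_bracket[OF unit_irrational]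
  \<comment> \<open>A point inside the interval of depth \<open>psum a t0\<close> leaves no earlier
    than that depth, so its block is at least \<open>t0\<close>.\<close>
  have "\<forall>\<^sub>F y in at x. y \<in> {lend x ?n0 <..< rend x ?n0} - {x}"
    by (rule eventually_at_in_open) (use br in auto)
  then show ?thesis
  proof (rule eventually_mono)
    fix y assume y: "y \<in> {lend x ?n0 <..< rend x ?n0} - {x}"
    let ?D = "(qmark y - qmark x) / (y - x)"
    show "\<exists>t\<ge>t0. real (cden a t) * real (cden a (t - 1)) / 2 ^ psum a (t + 2) \<le> ?D \<and>
      ?D \<le> 2 * (real (cden a (t + 3)))\<^sup>2 / 2 ^ psum a t"
    proof (cases "x < y")
      case True
      obtain n where n: "?n0 \<le> n" "y \<le> rend x n" "rend x (Suc n) < y"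
        by (rule crossing_index[OF lims(2) True, of ?n0]) (use y in auto)
      then have "\<not> turns_right x n" by (auto simp: ends_right)
      then show ?thesis
        using slope_bounds_right[OF unit_irrational n(3,2)] by (intro core[OF n(1)]) (auto simp: side_den_def)
    next
      case False
      have l: "(\<lambda>n. - lend x n) \<longlonglongrightarrow> - x" using lims(1) by (rule tendsto_minus)
      obtain n where n: "?n0 \<le> n" "- y \<le> - lend x n" "- lend x (Suc n) < - y"
        by (rule crossing_index[OF l, of "- y" ?n0]) (use y False in auto)
      then have n': "lend x n \<le> y" "y < lend x (Suc n)" by simp_all
      then have "turns_right x n" using ends_left(1)[of x n] by fastforce
      then show ?thesis
        using slope_bounds_left[OF unit_irrational n'(2,1)] by (intro core[OF n(1)]) (auto simp: side_den_def)
    qed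
  qed
qed

end

section \<open>Infinite derivative\<close>

text \<open>For small \<open>h\<close> the point \<open>x + h\<close> stays in the unit interval,
  where \<open>minkowski\<close> and \<open>qmark\<close> agree.\<close>

lemma has_ereal_derivative_minkowski_iff:
  assumes "0 < x" "x < 1"
  shows "has_ereal_derivative minkowski D x \<longleftrightarrow>
    ((\<lambda>y. ereal ((qmark y - qmark x) / (y - x))) \<longlongrightarrow> D) (at x)"
proof -
  have "\<forall>\<^sub>F y in at x. y \<in> {0<..<1} - {x}"
    by (rule eventually_at_in_open) (use assms in auto)
  then have "\<forall>\<^sub>F h in at 0. h + x \<in> {0<..<1} - {x}" by (subst (asm) eventually_at_to_0)
  then have "\<forall>\<^sub>F h in at 0. ereal ((minkowski (x + h) - minkowski x) / h) =
      ereal ((qmark (h + x) - qmark x) / (h + x - x))"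
    by (rule eventually_mono) (use assms in \<open>simp add: minkowski_eq_qmark add.commute\<close>)
  then show ?thesis
    unfolding has_ereal_derivative_def filterlim_at_to_0[of _ _ x] by (rule filterlim_cong[OF refl refl])
qed

section \<open>The golden ratio and the growth of denominators\<close>

lemma lambda1_gt_1: "1 < lambda1"
  by (simp add: lambda1_def)

lemma lambda1_sq: "lambda1\<^sup>2 = lambda1 + 1"
  by (simp add: lambda1_def power2_eq_square field_simps)

text \<open>\<open>kappa1\<close> is the logarithm of \<open>lambda1\<^sup>2\<close> to base 2; this
  puts the growth of denominators and the powers of 2 into one exponent.\<close>

lemma lambda1_power_eq_powr: "lambda1 ^ (2 * n) = 2 powr (kappa1 * real n)"
proof -
  have "2 powr (kappa1 * real n) = exp (real (2 * n) * ln lambda1)"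
    by (simp add: powr_def kappa1_def)
  also have "\<dots> = lambda1 ^ (2 * n)"
    using lambda1_gt_1 by (simp only: exp_of_nat_mult) simp
  finally show ?thesis by simp
qed

lemma kappa1_gt_1: "1 < kappa1"
proof -
  have "2 powr 1 < 2 powr (kappa1 * real 1)"
    unfolding lambda1_power_eq_powr[symmetric] using lambda1_gt_1 lambda1_sq by simp
  then show ?thesis by (subst (asm) powr_less_cancel_iff) auto
qed

text \<open>Partial quotients of at least 1 give at least Fibonacci growth. The factor
  \<open>lambda1\<close> on the right stands for an exponent \<open>t - 1\<close>, which
  \<open>t = 1\<close> with \<open>a 1 = 1\<close> already requires.\<close>

lemma cden_ge_lambda1_power:
  assumes "pos_seq a"
  shows "lambda1 ^ t \<le> real (cden a t) * lambda1"
proof (induction t rule: induct_nat_012)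
  case 0
  show ?case using lambda1_gt_1 by simp
next
  case 1
  show ?case using lambda1_gt_1 pos_seqD[OF assms, of 1] by simp
next
  case (ge2 t)
  have "lambda1 ^ Suc (Suc t) = lambda1 ^ Suc t + lambda1 ^ t"
  proof -
    have "lambda1 ^ Suc (Suc t) = lambda1\<^sup>2 * lambda1 ^ t" by (simp add: power2_eq_square)
    then show ?thesis by (simp add: lambda1_sq distrib_right)
  qed
  also have "\<dots> \<le> (real (cden a (Suc t)) + real (cden a t)) * lambda1"
    using ge2 by (simp add: distrib_right)
  also have "\<dots> \<le> real (cden a (Suc (Suc t))) * lambda1"
  proof (rule mult_right_mono)
    have "cden a (Suc t) \<le> a (Suc (Suc t)) * cden a (Suc t)"
      using pos_seqD[OF assms, of "Suc (Suc t)"] by (cases "a (Suc (Suc t))") auto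
    then have "cden a (Suc t) + cden a t \<le> cden a (Suc (Suc t))" by simp
    then show "real (cden a (Suc t)) + real (cden a t) \<le> real (cden a (Suc (Suc t)))"
      by (simp only: of_nat_add[symmetric] of_nat_le_iff)
  qed (use lambda1_gt_1 in simp)
  finally show ?case .
qed

text \<open>The numerator is at least \<open>lambda1 ^ (2 * t) / lambda1 ^ 3\<close>, the exponent
  below at most \<open>\<kappa> * (t + 2)\<close>; in base 2 the difference of the exponents grows
  like \<open>(kappa1 - \<kappa>) * t\<close>.\<close>

lemma cden_ratio_at_top:
  assumes a: "pos_seq a" and k: "\<kappa> < kappa1"
    and S: "\<forall>\<^sub>F t in sequentially. real (psum a t) \<le> \<kappa> * real t"
  shows "filterlim (\<lambda>t. real (cden a t) * real (cden a (t - 1)) / 2 ^ psum a (t + 2)) at_top sequentially"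
proof -
  define d where "d = kappa1 - \<kappa>"
  have d: "0 < d" using k by (simp add: d_def)
  have l: "0 < lambda1" using lambda1_gt_1 by simp
  then have "filterlim (\<lambda>t. 2 powr (d * real t - 2 * \<kappa>) / lambda1 ^ 3) at_top sequentially"
    using d by real_asymp
  then show ?thesis
  proof (rule filterlim_at_top_mono)
    have "\<forall>\<^sub>F t in sequentially. real (psum a (t + 2)) \<le> \<kappa> * real (t + 2)"
      using S by (subst eventually_sequentially_seg)
    then show "\<forall>\<^sub>F t in sequentially. 2 powr (d * real t - 2 * \<kappa>) / lambda1 ^ 3
        \<le> real (cden a t) * real (cden a (t - 1)) / 2 ^ psum a (t + 2)"
      using eventually_ge_at_top[of 1]
    proof eventually_elim
      case (elim t)
      have "lambda1 ^ t * lambda1 ^ (t - 1) \<le> (real (cden a t) * lambda1) * (real (cden a (t - 1)) * lambda1)"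
        using cden_ge_lambda1_power[OF a] l by (intro mult_mono) auto
      then have "lambda1 ^ t * lambda1 ^ (t - 1) * lambda1
          \<le> (real (cden a t) * lambda1) * (real (cden a (t - 1)) * lambda1) * lambda1"
        using l by (intro mult_right_mono) auto
      also have "lambda1 ^ t * lambda1 ^ (t - 1) * lambda1 = lambda1 ^ (2 * t)"
        using elim(2) by (cases t) (simp_all add: power_add mult_2)
      finally have c: "2 powr (kappa1 * real t) \<le> real (cden a t) * real (cden a (t - 1)) * lambda1 ^ 3"
        unfolding lambda1_power_eq_powr by (simp add: power3_eq_cube mult_ac)
      have p: "(2::real) ^ psum a (t + 2) \<le> 2 powr (\<kappa> * real (t + 2))"
        using elim(1) by (subst powr_realpow[symmetric]) (auto intro: powr_mono)
      have "2 powr (d * real t - 2 * \<kappa>) = 2 powr (kappa1 * real t) / 2 powr (\<kappa> * real (t + 2))"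
        by (simp add: d_def algebra_simps flip: powr_diff)
      also have "\<dots> \<le> real (cden a t) * real (cden a (t - 1)) * lambda1 ^ 3 / 2 ^ psum a (t + 2)"
        using c p l by (intro frac_le) auto
      finally show ?case using l by (simp add: field_simps)
    qed
  qed
qed

lemma infinite_derivative:
  assumes a: "pos_seq a"
    and ls: "limsup (\<lambda>t. ereal ((\<Sum>i=1..t. real (a i)) / real t)) < ereal kappa1"
  shows "has_ereal_derivative minkowski \<infinity> (cfrac_lim a)"
proof -
  let ?x = "cfrac_lim a"
  obtain \<kappa> where k: "limsup (\<lambda>t. ereal ((\<Sum>i=1..t. real (a i)) / real t)) < ereal \<kappa>" "\<kappa> < kappa1"
    using ereal_dense2[OF ls] by auto
  have "\<forall>\<^sub>F t in sequentially. ereal ((\<Sum>i=1..t. real (a i)) / real t) < ereal \<kappa>"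
    by (rule Limsup_lessD) (rule k)
  then have "\<forall>\<^sub>F t in sequentially. real (psum a t) \<le> \<kappa> * real t"
    using eventually_gt_at_top[of 0]
    by eventually_elim (simp add: psum_def pos_divide_less_eq)
  note lim = cden_ratio_at_top[OF a k(2) this]
  have "((\<lambda>y. ereal ((qmark y - qmark ?x) / (y - ?x))) \<longlongrightarrow> \<infinity>) (at ?x)"
    unfolding tendsto_PInfty
  proof
    fix r
    have "\<forall>\<^sub>F t in sequentially. r < real (cden a t) * real (cden a (t - 1)) / 2 ^ psum a (t + 2)"
      using lim by (auto simp: filterlim_at_top_dense)
    then obtain t0 where t0: "\<And>t. t0 \<le> t \<Longrightarrow> r < real (cden a t) * real (cden a (t - 1)) / 2 ^ psum a (t + 2)"
      unfolding eventually_sequentially by blast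
    have "\<forall>\<^sub>F y in at ?x. \<exists>t\<ge>max t0 1.
      real (cden a t) * real (cden a (t - 1)) / 2 ^ psum a (t + 2) \<le> (qmark y - qmark ?x) / (y - ?x) \<and>
      (qmark y - qmark ?x) / (y - ?x) \<le> 2 * (real (cden a (t + 3)))\<^sup>2 / 2 ^ psum a t"
      by (rule qmark_slope_bounds[OF a refl]) simp
    then show "\<forall>\<^sub>F y in at ?x. ereal r < ereal ((qmark y - qmark ?x) / (y - ?x))"
    proof (rule eventually_mono, elim exE conjE)
      fix y t assume "max t0 1 \<le> t"
        "real (cden a t) * real (cden a (t - 1)) / 2 ^ psum a (t + 2) \<le> (qmark y - qmark ?x) / (y - ?x)"
      then show "ereal r < ereal ((qmark y - qmark ?x) / (y - ?x))" using t0[of t] by simp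
    qed
  qed
  then show ?thesis
    using cfrac_lim_pos[OF a] cfrac_lim_less_1[OF a] by (simp add: has_ereal_derivative_minkowski_iff)
qed

section \<open>Zero derivative at a quadratic irrational\<close>

lemma zero_derivative:
  assumes a: "pos_seq a"
    and lim: "(\<lambda>t. 2 * (real (cden a (t + 3)))\<^sup>2 / 2 ^ psum a t) \<longlonglongrightarrow> 0"
  shows "has_ereal_derivative minkowski 0 (cfrac_lim a)"
proof -
  let ?x = "cfrac_lim a"
  have "((\<lambda>y. (qmark y - qmark ?x) / (y - ?x)) \<longlongrightarrow> 0) (at ?x)"
  proof (rule tendstoI)
    fix e :: real assume "0 < e"
    then have "\<forall>\<^sub>F t in sequentially. 2 * (real (cden a (t + 3)))\<^sup>2 / 2 ^ psum a t < e"
      using order_tendstoD(2)[OF lim] by simp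
    then obtain t0 where t0: "\<And>t. t0 \<le> t \<Longrightarrow> 2 * (real (cden a (t + 3)))\<^sup>2 / 2 ^ psum a t < e"
      unfolding eventually_sequentially by blast
    have "\<forall>\<^sub>F y in at ?x. \<exists>t\<ge>max t0 1.
      real (cden a t) * real (cden a (t - 1)) / 2 ^ psum a (t + 2) \<le> (qmark y - qmark ?x) / (y - ?x) \<and>
      (qmark y - qmark ?x) / (y - ?x) \<le> 2 * (real (cden a (t + 3)))\<^sup>2 / 2 ^ psum a t"
      by (rule qmark_slope_bounds[OF a refl]) simp
    then show "\<forall>\<^sub>F y in at ?x. dist ((qmark y - qmark ?x) / (y - ?x)) 0 < e"
    proof (rule eventually_mono, elim exE conjE)
      fix y t assume t: "max t0 1 \<le> t"
        and lo: "real (cden a t) * real (cden a (t - 1)) / 2 ^ psum a (t + 2) \<le> (qmark y - qmark ?x) / (y - ?x)"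
        and up: "(qmark y - qmark ?x) / (y - ?x) \<le> 2 * (real (cden a (t + 3)))\<^sup>2 / 2 ^ psum a t"
      have "0 \<le> real (cden a t) * real (cden a (t - 1)) / 2 ^ psum a (t + 2)" by simp
      then have "0 \<le> (qmark y - qmark ?x) / (y - ?x)" using lo by (rule order.trans)
      moreover have "(qmark y - qmark ?x) / (y - ?x) < e" using up t0[of t] t by simp
      ultimately show "dist ((qmark y - qmark ?x) / (y - ?x)) 0 < e"
        by (simp only: dist_real_def diff_zero abs_of_nonneg)
    qed
  qed
  then have "((\<lambda>y. ereal ((qmark y - qmark ?x) / (y - ?x))) \<longlongrightarrow> 0) (at ?x)"
    unfolding zero_ereal_def by (rule tendsto_ereal)
  then show ?thesis
    using cfrac_lim_pos[OF a] cfrac_lim_less_1[OF a] by (simp add: has_ereal_derivative_minkowski_iff)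
qed

section \<open>Periodic continued fractions\<close>

text \<open>Unfolding \<open>n\<close> partial quotients makes the value a Moebius image of the
  tail. Positivity of \<open>\<gamma>\<close> will keep the quadratic equation of a periodic
  fraction from degenerating; \<open>0 < \<delta>\<close> is carried along because
  \<open>\<delta>\<close> becomes the next \<open>\<gamma>\<close>.\<close>

lemma cfrac_lim_moebius:
  assumes a: "pos_seq a"
  shows "\<exists>\<alpha> \<beta> \<gamma> \<delta> :: nat. 0 < \<delta> \<and> (0 < n \<longrightarrow> 0 < \<gamma>) \<and>
    cfrac_lim a * (real \<gamma> * cfrac_lim (\<lambda>i. a (i + n)) + real \<delta>) =
      real \<alpha> * cfrac_lim (\<lambda>i. a (i + n)) + real \<beta>"
proof (induction n)
  case 0
  show ?case by (rule exI[of _ 1], rule exI[of _ 0], rule exI[of _ 0], rule exI[of _ 1]) simp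
next
  case (Suc n)
  let ?y = "cfrac_lim (\<lambda>i. a (i + n))" and ?z = "cfrac_lim (\<lambda>i. a (i + Suc n))" and ?A = "a (Suc n)"
  obtain \<alpha> \<beta> \<gamma> \<delta> :: nat where IH: "0 < \<delta>"
    "cfrac_lim a * (real \<gamma> * ?y + real \<delta>) = real \<alpha> * ?y + real \<beta>"
    using Suc by blast
  have y: "1 = ?y * (real ?A + ?z)"
    using cfrac_lim_inverse[OF pos_seq_shift[OF a, of n]] cfrac_lim_pos[OF pos_seq_shift[OF a, of n]]
    by (simp add: field_simps)
  have "cfrac_lim a * (real \<gamma> + real \<delta> * (real ?A + ?z)) = cfrac_lim a * (real \<gamma> * ?y + real \<delta>) * (real ?A + ?z)"
  proof -
    have "(real \<gamma> * ?y + real \<delta>) * (real ?A + ?z) = real \<gamma> * (?y * (real ?A + ?z)) + real \<delta> * (real ?A + ?z)"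
      by (simp add: distrib_right)
    then show ?thesis unfolding y[symmetric] by simp
  qed
  also have "\<dots> = real \<alpha> * (?y * (real ?A + ?z)) + real \<beta> * (real ?A + ?z)"
    unfolding IH(2) by (simp add: algebra_simps)
  also have "\<dots> = real \<alpha> + real \<beta> * (real ?A + ?z)" unfolding y[symmetric] by simp
  finally have "cfrac_lim a * (real \<delta> * ?z + real (\<gamma> + \<delta> * ?A)) = real \<beta> * ?z + real (\<alpha> + \<beta> * ?A)"
    by (simp add: algebra_simps)
  moreover have "0 < \<gamma> + \<delta> * ?A" using IH(1) pos_seqD[OF a, of "Suc n"] by simp
  ultimately show ?case using IH(1) by blast
qed

lemma periodic_quadratic:
  assumes a: "pos_seq a" and per: "\<And>i. a (i + k) = a i" and k: "0 < k"
  shows "quadratic_irrational (cfrac_lim a)"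
proof -
  obtain \<alpha> \<beta> \<gamma> \<delta> :: nat where "0 < \<gamma>"
    "cfrac_lim a * (real \<gamma> * cfrac_lim a + real \<delta>) = real \<alpha> * cfrac_lim a + real \<beta>"
    using cfrac_lim_moebius[OF a, of k] k by (auto simp: per)
  then have "int \<gamma> \<noteq> 0 \<and> of_int (int \<gamma>) * (cfrac_lim a)\<^sup>2 + of_int (int \<delta> - int \<alpha>) * cfrac_lim a
      + of_int (- int \<beta>) = 0"
    by (simp add: power2_eq_square algebra_simps)
  then show ?thesis unfolding quadratic_irrational_def using cfrac_lim_irrational[OF a] by blast
qed

text \<open>Divisibility puts \<open>B\<close> after each \<open>m\<close> ones when counting from
  index 1, and makes the periodicity hold at the ignored index 0 too.\<close>

definition spike_seq :: "nat \<Rightarrow> nat \<Rightarrow> nat \<Rightarrow> nat" where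
  "spike_seq m B i = (if Suc m dvd i then B else 1)"

lemma spike_seq_pos: "1 \<le> B \<Longrightarrow> pos_seq (spike_seq m B)"
  by (simp add: pos_seq_def spike_seq_def)

lemma spike_seq_periodic: "spike_seq m B (i + Suc m) = spike_seq m B i"
  by (simp only: spike_seq_def dvd_add_left_iff[OF dvd_refl])

lemma psum_spike_seq:
  assumes "1 \<le> B"
  shows "psum (spike_seq m B) t = t + (B - 1) * (t div Suc m)"
proof (induction t)
  case (Suc t)
  then show ?case using assms
    by (cases "Suc m dvd Suc t") (auto simp: spike_seq_def div_Suc dvd_eq_mod_eq_0)
qed simp

lemma cden_Suc_le:
  assumes "pos_seq a"
  shows "cden a (Suc n) \<le> (a (Suc n) + 1) * cden a n"
proof (cases n)
  case (Suc j)
  then show ?thesis using cden_mono[OF assms, of j "Suc j"] by simp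
qed simp

text \<open>Inside a run of ones the denominators follow the Fibonacci recurrence. The exponent is
  \<open>Suc i\<close> because the first step is only bounded by a doubling, and 2 exceeds
  \<open>lambda1\<close> but not \<open>lambda1\<^sup>2\<close>.\<close>

lemma cden_spike_seq_run:
  assumes B: "1 \<le> B" and i: "i \<le> m"
  shows "real (cden (spike_seq m B) (j * Suc m + i)) \<le> lambda1 ^ Suc i * real (cden (spike_seq m B) (j * Suc m))"
  using i
proof (induction i rule: induct_nat_012)
  case 0
  show ?case using lambda1_gt_1 by (simp add: mult_le_cancel_right1)
next
  case 1
  let ?n = "j * Suc m"
  have "\<not> Suc m dvd ?n + 1" unfolding dvd_add_right_iff[OF dvd_triv_right] using 1 by simp
  then have "spike_seq m B (Suc ?n) = 1" by (simp add: spike_seq_def)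
  then have "cden (spike_seq m B) (Suc ?n) \<le> 2 * cden (spike_seq m B) ?n"
    using cden_Suc_le[OF spike_seq_pos[OF B], of m ?n] by simp
  then have "real (cden (spike_seq m B) (Suc ?n)) \<le> 2 * real (cden (spike_seq m B) ?n)" by linarith
  also have "\<dots> \<le> lambda1 ^ Suc (Suc 0) * real (cden (spike_seq m B) ?n)"
    using lambda1_sq lambda1_gt_1 by (intro mult_right_mono) (auto simp: power2_eq_square)
  finally show ?case by simp
next
  case (ge2 i)
  let ?n = "j * Suc m"
  have "\<not> Suc m dvd Suc (Suc i)" using ge2.prems by (auto dest: dvd_imp_le)
  then have "\<not> Suc m dvd ?n + Suc (Suc i)" by (simp only: dvd_add_right_iff[OF dvd_triv_right]) simp
  then have "cden (spike_seq m B) (?n + Suc (Suc i)) =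
      cden (spike_seq m B) (?n + Suc i) + cden (spike_seq m B) (?n + i)"
    by (simp add: spike_seq_def)
  then have "real (cden (spike_seq m B) (?n + Suc (Suc i))) =
      real (cden (spike_seq m B) (?n + Suc i)) + real (cden (spike_seq m B) (?n + i))"
    by (simp only: of_nat_add)
  also have "\<dots> \<le> lambda1 ^ Suc (Suc i) * real (cden (spike_seq m B) ?n) + lambda1 ^ Suc i * real (cden (spike_seq m B) ?n)"
    by (rule add_mono; rule ge2.IH) (use ge2.prems in simp_all)
  also have "\<dots> = lambda1 ^ Suc i * (lambda1 + 1) * real (cden (spike_seq m B) ?n)"
    by (simp add: algebra_simps)
  also have "\<dots> = lambda1 ^ Suc (Suc (Suc i)) * real (cden (spike_seq m B) ?n)"
    unfolding lambda1_sq[symmetric] by (simp add: power2_eq_square)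
  finally show ?case .
qed

text \<open>In one period the run of ones costs at most the factor \<open>lambda1 ^ Suc m\<close>,
  and the quotient \<open>B\<close> at most \<open>B + 1\<close>.\<close>

lemma cden_spike_seq_le:
  assumes B: "1 \<le> B"
  shows "real (cden (spike_seq m B) (j * Suc m)) \<le> (real (B + 1) * lambda1 ^ Suc m) ^ j"
proof (induction j)
  case (Suc j)
  let ?a = "spike_seq m B"
  have e: "Suc j * Suc m = Suc (j * Suc m + m)" by simp
  have "?a (Suc (j * Suc m + m)) = B" unfolding e[symmetric] by (simp add: spike_seq_def del: mult_Suc mult_Suc_right)
  then have "cden ?a (Suc j * Suc m) \<le> (B + 1) * cden ?a (j * Suc m + m)"
    using cden_Suc_le[OF spike_seq_pos[OF B], of m "j * Suc m + m"] unfolding e by simp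
  then have "real (cden ?a (Suc j * Suc m)) \<le> real ((B + 1) * cden ?a (j * Suc m + m))"
    by (simp only: of_nat_le_iff)
  also have "\<dots> = real (B + 1) * real (cden ?a (j * Suc m + m))" by (rule of_nat_mult)
  also have "\<dots> \<le> real (B + 1) * (lambda1 ^ Suc m * real (cden ?a (j * Suc m)))"
    by (intro mult_left_mono cden_spike_seq_run[OF B]) auto
  also have "\<dots> \<le> real (B + 1) * (lambda1 ^ Suc m * (real (B + 1) * lambda1 ^ Suc m) ^ j)"
    using Suc lambda1_gt_1 by (intro mult_left_mono) auto
  finally show ?case by (simp only: power_Suc mult.assoc)
qed simp

lemma filterlim_div_at_top: "filterlim (\<lambda>t. t div Suc m) at_top sequentially"
  unfolding filterlim_at_top eventually_sequentially
proof
  fix Z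
  have "Z \<le> t div Suc m" if "Z * Suc m \<le> t" for t
    using div_le_mono[OF that, of "Suc m"] by (simp del: mult_Suc_right)
  then show "\<exists>N. \<forall>t\<ge>N. Z \<le> t div Suc m" by blast
qed

lemma spike_seq_zero_derivative:
  assumes B: "1 \<le> B" and less: "(real (B + 1) * lambda1 ^ Suc m)\<^sup>2 < 2 ^ (m + B)"
  shows "has_ereal_derivative minkowski 0 (cfrac_lim (spike_seq m B))"
proof (rule zero_derivative[OF spike_seq_pos[OF B]])
  let ?a = "spike_seq m B"
  define A where "A = real (B + 1) * lambda1 ^ Suc m"
  define r where "r = A\<^sup>2 / 2 ^ (m + B)"
  have A1: "1 \<le> A"
  proof -
    have "1 * 1 \<le> real (B + 1) * lambda1 ^ Suc m"
      using lambda1_gt_1 by (intro mult_mono one_le_power) auto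
    then show ?thesis by (simp add: A_def)
  qed
  have r: "0 \<le> r" "r < 1" using less by (simp_all add: r_def A_def)
  show "(\<lambda>t. 2 * (real (cden ?a (t + 3)))\<^sup>2 / 2 ^ psum ?a t) \<longlonglongrightarrow> 0"
  proof (rule Lim_null_comparison)
    have "(\<lambda>t. r ^ (t div Suc m)) \<longlonglongrightarrow> 0"
      using LIMSEQ_realpow_zero[OF r] filterlim_div_at_top by (rule filterlim_compose)
    then show "(\<lambda>t. 2 * A ^ 8 * r ^ (t div Suc m)) \<longlonglongrightarrow> 0"
      by (rule tendsto_mult_right_zero)
    have "norm (2 * (real (cden ?a (t + 3)))\<^sup>2 / 2 ^ psum ?a t) \<le> 2 * A ^ 8 * r ^ (t div Suc m)" for t
    proof -
      \<comment> \<open>The number of complete periods up to \<open>t\<close>. Index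
        \<open>t + 3\<close> is reached within \<open>j + 4\<close> periods, and squaring
        \<open>A ^ (j + 4)\<close> yields the constant \<open>A ^ 8\<close>.\<close>
      define j where "j = t div Suc m"
      have jt: "j * Suc m \<le> t" unfolding j_def by (rule div_times_less_eq_dividend)
      have "t < Suc j * Suc m"
        unfolding j_def using dividend_less_div_times[of "Suc m" t] by simp
      then have "t + 3 \<le> (j + 4) * Suc m" by (simp add: algebra_simps)
      then have "real (cden ?a (t + 3)) \<le> real (cden ?a ((j + 4) * Suc m))"
        using cden_mono[OF spike_seq_pos[OF B]] by (simp only: of_nat_le_iff)
      also have "\<dots> \<le> A ^ (j + 4)" unfolding A_def by (rule cden_spike_seq_le[OF B])
      finally have "(real (cden ?a (t + 3)))\<^sup>2 \<le> (A ^ (j + 4))\<^sup>2" by (intro power_mono) auto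
      also have "\<dots> = A ^ 8 * (A\<^sup>2) ^ j" by (simp add: power_add power_mult_distrib flip: power_mult) (simp add: mult.commute)
      finally have c: "(real (cden ?a (t + 3)))\<^sup>2 \<le> A ^ 8 * (A\<^sup>2) ^ j" .
      \<comment> \<open>Each complete period contributes \<open>m + B\<close> to the partial
        sum.\<close>
      have "j * (m + B) = j * Suc m + (B - 1) * j" using B by (cases B) (simp_all add: algebra_simps)
      also have "\<dots> \<le> psum ?a t" using jt by (simp only: psum_spike_seq[OF B] j_def[symmetric] add_le_cancel_right)
      finally have "(2 ^ (m + B)) ^ j \<le> (2::real) ^ psum ?a t"
        unfolding power_mult[symmetric] by (intro power_increasing) (auto simp: mult.commute)
      then have "(real (cden ?a (t + 3)))\<^sup>2 / 2 ^ psum ?a t \<le> (A ^ 8 * (A\<^sup>2) ^ j) / (2 ^ (m + B)) ^ j"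
        using c by (intro frac_le) auto
      then show ?thesis by (simp add: r_def power_divide flip: j_def)
    qed
    then show "\<forall>\<^sub>F t in sequentially. norm (2 * (real (cden ?a (t + 3)))\<^sup>2 / 2 ^ psum ?a t)
        \<le> 2 * A ^ 8 * r ^ (t div Suc m)"
      by simp
  qed
qed

text \<open>By \<open>psum_spike_seq\<close> the mean is determined by the share of spikes
  \<open>(t div Suc m) / t\<close>, which differs from \<open>1 / Suc m\<close> by at most
  \<open>1 / t\<close>.\<close>

lemma spike_seq_mean:
  assumes B: "1 \<le> B"
  shows "(\<lambda>t. (\<Sum>i=1..t. real (spike_seq m B i)) / real t) \<longlonglongrightarrow> (real m + real B) / (real m + 1)"
proof -
  have "(\<lambda>t. real (t div Suc m) / real t - 1 / real (Suc m)) \<longlonglongrightarrow> 0"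
  proof (rule Lim_null_comparison)
    show "(\<lambda>t. 1 / real t) \<longlonglongrightarrow> 0" by real_asymp
    show "\<forall>\<^sub>F t in sequentially. norm (real (t div Suc m) / real t - 1 / real (Suc m)) \<le> 1 / real t"
      using eventually_gt_at_top[of 0]
    proof eventually_elim
      case (elim t)
      have "real t = real (t div Suc m) * real (Suc m) + real (t mod Suc m)"
        by (simp only: of_nat_mult[symmetric] of_nat_add[symmetric] div_mult_mod_eq)
      then have "real (t div Suc m) / real t - 1 / real (Suc m) = - (real (t mod Suc m) / real (Suc m)) / real t"
        using elim by (simp add: divide_simps del: of_nat_Suc)
      moreover have "real (t mod Suc m) / real (Suc m) \<le> 1"
        using mod_less_divisor[of "Suc m" t] by (simp add: divide_le_eq del: mod_less_divisor)
      then have "real (t mod Suc m) / real (Suc m) / real t \<le> 1 / real t" by (rule divide_right_mono) simp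
      ultimately show ?case by (simp del: of_nat_Suc)
    qed
  qed
  then have "(\<lambda>t. real (t div Suc m) / real t) \<longlonglongrightarrow> 1 / real (Suc m)" by (simp only: LIM_zero_iff)
  then have "(\<lambda>t. 1 + (real B - 1) * (real (t div Suc m) / real t)) \<longlonglongrightarrow> 1 + (real B - 1) * (1 / real (Suc m))"
    by (intro tendsto_add tendsto_mult tendsto_const)
  also have "1 + (real B - 1) * (1 / real (Suc m)) = (real m + real B) / (real m + 1)"
    by (simp add: field_simps)
  finally have lim: "(\<lambda>t. 1 + (real B - 1) * (real (t div Suc m) / real t)) \<longlonglongrightarrow> (real m + real B) / (real m + 1)" .
  show ?thesis
  proof (rule Lim_transform_eventually[OF lim])
    show "\<forall>\<^sub>F t in sequentially. 1 + (real B - 1) * (real (t div Suc m) / real t) =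
        (\<Sum>i=1..t. real (spike_seq m B i)) / real t"
      using eventually_gt_at_top[of 0]
    proof eventually_elim
      case (elim t)
      have "(\<Sum>i=1..t. real (spike_seq m B i)) = real (psum (spike_seq m B) t)" by (simp add: psum_def)
      also have "\<dots> = real t + (real B - 1) * real (t div Suc m)"
        unfolding psum_spike_seq[OF B] using B by (simp add: of_nat_diff)
      finally show ?case using elim by (simp add: add_divide_distrib)
    qed
  qed
qed

lemma exists_spike_seq:
  assumes "0 < \<epsilon>"
  obtains m B where "1 \<le> B" "(real (B + 1) * lambda1 ^ Suc m)\<^sup>2 < 2 ^ (m + B)"
    "(real m + real B) / (real m + 1) \<le> kappa1 + \<epsilon>"
proof -
  \<comment> \<open>With \<open>B\<close> about \<open>c * m\<close>, the exponent
    \<open>m + B\<close> exceeds \<open>kappa1 * m\<close> by at least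
    \<open>\<epsilon> / 2 * m\<close>, which for large \<open>m\<close> outweighs the polynomial
    factor \<open>(B + 1)\<^sup>2 * lambda1\<^sup>2\<close>.\<close>
  define c where "c = kappa1 - 1 + \<epsilon> / 2"
  have c: "0 < c" using kappa1_gt_1 assms by (simp add: c_def)
  have "0 < lambda1" using lambda1_gt_1 by simp
  then have "\<forall>\<^sub>F m in sequentially. (c * real m + 2)\<^sup>2 * lambda1\<^sup>2 < 2 powr (\<epsilon> / 2 * real m)"
    using c assms by real_asymp
  then have "\<forall>\<^sub>F m in sequentially. 1 \<le> m \<and> (c * real m + 2)\<^sup>2 * lambda1\<^sup>2 < 2 powr (\<epsilon> / 2 * real m)"
    by (intro eventually_conj eventually_ge_at_top)
  then obtain m where m: "1 \<le> m" "(c * real m + 2)\<^sup>2 * lambda1\<^sup>2 < 2 powr (\<epsilon> / 2 * real m)"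
    using eventually_happens'[OF sequentially_bot] by blast
  define B where "B = nat \<lceil>c * real m\<rceil>"
  have cm: "0 < c * real m" using c m by simp
  then have B: "1 \<le> B" "c * real m \<le> real B" "real B \<le> c * real m + 1"
    unfolding B_def by linarith+
  have "(real (B + 1) * lambda1 ^ Suc m)\<^sup>2 = (real (B + 1))\<^sup>2 * lambda1\<^sup>2 * lambda1 ^ (2 * m)"
    by (simp add: power_mult_distrib power_mult power2_eq_square)
  also have "\<dots> \<le> (c * real m + 2)\<^sup>2 * lambda1\<^sup>2 * lambda1 ^ (2 * m)"
    using B lambda1_gt_1 by (intro mult_right_mono power_mono) auto
  also have "\<dots> < 2 powr (\<epsilon> / 2 * real m) * lambda1 ^ (2 * m)"
    using m(2) lambda1_gt_1 by (intro mult_strict_right_mono) auto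
  also have "\<dots> = 2 powr (real m + c * real m)"
    unfolding lambda1_power_eq_powr powr_add[symmetric] by (simp add: c_def algebra_simps)
  also have "\<dots> \<le> 2 powr (real (m + B))" using B by (intro powr_mono) auto
  also have "\<dots> = 2 ^ (m + B)" by (simp only: powr_realpow)
  finally have "(real (B + 1) * lambda1 ^ Suc m)\<^sup>2 < 2 ^ (m + B)" .
  moreover have "(real m + real B) / (real m + 1) \<le> kappa1 + \<epsilon>"
  proof -
    have "real m + real B \<le> (kappa1 + \<epsilon> / 2) * real m + 1"
      using B(3) by (simp add: c_def algebra_simps)
    also have "\<dots> \<le> (kappa1 + \<epsilon>) * (real m + 1)"
    proof -
      have "0 \<le> \<epsilon> / 2 * real m" using assms by simp
      moreover have "(kappa1 + \<epsilon>) * (real m + 1) = (kappa1 + \<epsilon> / 2) * real m + \<epsilon> / 2 * real m + kappa1 + \<epsilon>"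
        by (simp add: field_simps)
      \<comment> \<open>The 1 lost by rounding \<open>B\<close> up is absorbed by
        \<open>kappa1 > 1\<close>.\<close>
      ultimately show ?thesis using kappa1_gt_1 assms by linarith
    qed
    finally show ?thesis by (simp add: pos_divide_le_eq)
  qed
  ultimately show ?thesis using that B(1) by blast
qed

theorem theorem1:
  shows "(\<forall>(x :: real) (a :: nat \<Rightarrow> nat).
            0 < x \<and> x < 1 \<and> x \<notin> \<rat> \<and> is_cfrac x a \<and>
            limsup (\<lambda>t. ereal ((\<Sum>i=1..t. real (a i)) / real t)) < ereal kappa1
            \<longrightarrow> has_ereal_derivative minkowski \<infinity> x)
       \<and> (\<forall>\<epsilon> :: real. \<epsilon> > 0 \<longrightarrow>
            (\<exists>(x :: real) (a :: nat \<Rightarrow> nat) (L :: real).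
               quadratic_irrational x \<and> 0 < x \<and> x < 1 \<and> is_cfrac x a \<and>
               (\<lambda>t. (\<Sum>i=1..t. real (a i)) / real t) \<longlonglongrightarrow> L \<and> L \<le> kappa1 + \<epsilon> \<and>
               has_ereal_derivative minkowski 0 x))"
proof (intro conjI allI impI)
  fix x a
  assume "0 < x \<and> x < 1 \<and> x \<notin> \<rat> \<and> is_cfrac x a \<and>
    limsup (\<lambda>t. ereal ((\<Sum>i=1..t. real (a i)) / real t)) < ereal kappa1"
  then show "has_ereal_derivative minkowski \<infinity> x"
    using infinite_derivative by (auto simp: is_cfrac_iff)
next
  fix \<epsilon> :: real assume "0 < \<epsilon>"
  then obtain m B where mB: "1 \<le> B" "(real (B + 1) * lambda1 ^ Suc m)\<^sup>2 < 2 ^ (m + B)"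
    "(real m + real B) / (real m + 1) \<le> kappa1 + \<epsilon>"
    by (rule exists_spike_seq)
  note a = spike_seq_pos[OF mB(1), of m]
  show "\<exists>x a L. quadratic_irrational x \<and> 0 < x \<and> x < 1 \<and> is_cfrac x a \<and>
      (\<lambda>t. (\<Sum>i=1..t. real (a i)) / real t) \<longlonglongrightarrow> L \<and> L \<le> kappa1 + \<epsilon> \<and>
      has_ereal_derivative minkowski 0 x"
  proof (intro exI conjI)
    show "quadratic_irrational (cfrac_lim (spike_seq m B))"
      using spike_seq_periodic by (rule periodic_quadratic[OF a]) simp
    show "0 < cfrac_lim (spike_seq m B)" "cfrac_lim (spike_seq m B) < 1"
      by (rule cfrac_lim_pos[OF a], rule cfrac_lim_less_1[OF a])
    show "is_cfrac (cfrac_lim (spike_seq m B)) (spike_seq m B)" using a by (simp add: is_cfrac_iff)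
  qed (fact spike_seq_mean[OF mB(1)] mB(3) spike_seq_zero_derivative[OF mB(1,2)])+
qed

end
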